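(* Let $G$ be a torsion-free group, let $p_1,\dots,p_k$ be primes, let $\alpha_1,\dots,\alpha_k\ge 1$ be integers, and let $H\cong G\oplus \mathbb{Z}_{p_1^{\alpha_1}}\oplus\cdots\oplus\mathbb{Z}_{p_k^{\alpha_k}}$. Let $\mathbb{H}$ be an infinite dimensional real Hilbert space whose Hilbert basis has the same cardinality as $G$, let $p$ be a positive integer, and let $\mathbf{St}(p,\mathbb{H})$ be the Stiefel manifold of orthonormal $p$-frames in $\mathbb{H}$. Then $H$ acts linearly, isometrically and properly discontinuously on $\mathbf{St}(p,\mathbb{H})$ (i.e. there exists such an action) if and only if $p_i\neq p_j$ whenever $i\neq j$. Moreover, $G$ acts properly discontinuously on the Grassmann manifold $\mathbf{Gr}(p,\mathbb{H})$ (i.e. there exists such an action).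
   Context: $\mathbf{St}(p,\mathbb{H})=\{x\in L(\mathbb{R}^p,\mathbb{H}) : x^t\circ x=\mathrm{Id}_{\mathbb{R}^p}\}$ is the set of linear isometric immersions $\mathbb{R}^p\to\mathbb{H}$, a closed submanifold of the Hilbert space $L(\mathbb{R}^p,\mathbb{H})$ of linear maps with inner product $\langle x,y\rangle=\mathrm{Tr}(x^t\circ y)$; it carries the induced Riemannian metric. $\mathbf{Gr}(p,\mathbb{H})=\mathbf{St}(p,\mathbb{H})/\mathrm{O}(p)$ (action $(A,x)\mapsto x\circ A^t$) is the manifold of $p$-dimensional subspaces of $\mathbb{H}$. A group acts linearly and isometrically on $\mathbf{St}(p,\mathbb{H})$ when it acts on $\mathbb{H}$ by (surjective) linear isometries and on $\mathbf{St}(p,\mathbb{H})$ by the induced action $(h,x)\mapsto h\circ x$. An action of a group $\Gamma$ on a manifold $M$ by diffeomorphisms is properly discontinuous if: (1) every $x\in M$ has an open neighbourhood $U$ with $g(U)\cap U=\emptyset$ for every $g\neq e$; (2) whenever $y\notin \Gamma(x)$ (the orbit of $x$), there are neighbourhoods $U$ of $x$ and $V$ of $y$ with $g(U)\cap V=\emptyset$ for every $g\in\Gamma$. $\mathbb{Z}_m$ denotes the cyclic group of order $m$. *)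

theory Defs
  imports
    "HOL-Analysis.Analysis"
    "HOL-Algebra.Group_Action"
    "HOL-Algebra.Product_Groups"
    "HOL-Library.Equipollence"
    "HOL-Computational_Algebra.Primes"
begin

definition torsion_free :: "('a, 'b) monoid_scheme \<Rightarrow> bool" where
  "torsion_free G \<longleftrightarrow>
     (\<forall>x\<in>carrier G. \<forall>n::nat. n > 0 \<and> x [^]\<^bsub>G\<^esub> n = \<one>\<^bsub>G\<^esub> \<longrightarrow> x = \<one>\<^bsub>G\<^esub>)"

definition hilbert_basis :: "'h::real_inner set \<Rightarrow> bool" where
  "hilbert_basis B \<longleftrightarrow>
     pairwise orthogonal B \<and> (\<forall>b\<in>B. norm b = 1) \<and> closure (span B) = UNIV"

definition infinite_dimensional :: "'h::real_vector itself \<Rightarrow> bool" where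
  "infinite_dimensional _ \<longleftrightarrow> \<not> (\<exists>S::'h set. finite S \<and> span S = UNIV)"


section \<open>Smooth maps\<close>

text \<open>
  Frechet C-infinity maps on an open set. \<open>D x [v\<^sub>1, \<dots>, v\<^sub>n]\<close> is the \<open>n\<close>-th derivative at
  \<open>x\<close>, a bounded \<open>n\<close>-linear map; the last clause says that the \<open>n\<close>-th derivative, as a map into
  the normed space of bounded \<open>n\<close>-linear maps, is Frechet differentiable at \<open>x\<close> with derivative
  \<open>h \<mapsto> D x (h # \<cdot>)\<close>. Lists are used because the iterated spaces of bounded linear maps
  have different types for different \<open>n\<close>.
\<close>

definition smooth_on_open ::
    "'a::real_normed_vector set \<Rightarrow> ('a \<Rightarrow> 'b::real_normed_vector) \<Rightarrow> bool" where
  "smooth_on_open W f \<longleftrightarrow> open W \<and>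
     (\<exists>D :: 'a \<Rightarrow> 'a list \<Rightarrow> 'b. \<forall>x\<in>W.
        D x [] = f x \<and>
        (\<forall>us ws. linear (\<lambda>v. D x (us @ v # ws))) \<and>
        (\<forall>n. \<exists>C. \<forall>vs. length vs = n \<longrightarrow> norm (D x vs) \<le> C * (\<Prod>v\<leftarrow>vs. norm v)) \<and>
        (\<forall>n. \<forall>\<epsilon>>0. \<exists>\<delta>>0. \<forall>h vs. norm h < \<delta> \<and> length vs = n \<longrightarrow>
           norm (D (x + h) vs - D x vs - D x (h # vs)) \<le> \<epsilon> * norm h * (\<Prod>v\<leftarrow>vs. norm v)))"

text \<open>
  Smoothness on a subset of a normed space is local extendability to a smooth map on an open set.
  It is applied below only to the Stiefel manifold and to relatively open subsets of closed
  linear subspaces of a Hilbertable space; there it is the usual notion for submanifolds.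
\<close>

definition smooth_on_subset ::
    "'a::real_normed_vector set \<Rightarrow> ('a \<Rightarrow> 'b::real_normed_vector) \<Rightarrow> bool" where
  "smooth_on_subset S f \<longleftrightarrow>
     (\<forall>x\<in>S. \<exists>W F. x \<in> W \<and> smooth_on_open W F \<and> (\<forall>y\<in>S \<inter> W. F y = f y))"


section \<open>The Stiefel manifold\<close>

text \<open>
  The integer \<open>p \<ge> 1\<close> is \<open>CARD('p)\<close>. The space of linear maps from \<open>real^'p\<close> to \<open>'h\<close> carries the
  operator norm, which is equivalent to the Hilbert norm given by \<open>\<langle>x, y\<rangle> = Tr (x\<^sup>t \<circ> y)\<close>, so that
  it induces the same topology and the same smooth maps.
\<close>

definition stiefel :: "((real, 'p::finite) vec \<Rightarrow>\<^sub>L 'h::real_inner) set" where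
  "stiefel = {x. adjoint (blinfun_apply x) \<circ> blinfun_apply x = id}"

definition stiefel_topology :: "((real, 'p::finite) vec \<Rightarrow>\<^sub>L 'h::real_inner) topology" where
  "stiefel_topology = top_of_set stiefel"

definition stiefel_diffeos ::
    "(((real, 'p::finite) vec \<Rightarrow>\<^sub>L 'h::real_inner) \<Rightarrow> ((real, 'p) vec \<Rightarrow>\<^sub>L 'h)) set" where
  "stiefel_diffeos = {F. bij_betw F stiefel stiefel \<and>
     smooth_on_subset stiefel F \<and> smooth_on_subset stiefel (inv_into stiefel F)}"


section \<open>The Grassmann manifold\<close>

definition gr_class ::
    "((real, 'p::finite) vec \<Rightarrow>\<^sub>L 'h::real_inner) \<Rightarrow> ((real, 'p) vec \<Rightarrow>\<^sub>L 'h) set" where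
  "gr_class x = {y. \<exists>A :: real^'p^'p. orthogonal_matrix A \<and>
     blinfun_apply y = blinfun_apply x \<circ> (\<lambda>v. transpose A *v v)}"

definition grassmann :: "((real, 'p::finite) vec \<Rightarrow>\<^sub>L 'h::real_inner) set set" where
  "grassmann = gr_class ` stiefel"

definition grassmann_topology :: "((real, 'p::finite) vec \<Rightarrow>\<^sub>L 'h::real_inner) set topology" where
  "grassmann_topology = topology (\<lambda>U. U \<subseteq> grassmann \<and>
     openin stiefel_topology {x \<in> stiefel. gr_class x \<in> U})"

lemma openin_grassmann_topology:
  fixes U :: "((real, 'p::finite) vec \<Rightarrow>\<^sub>L 'h::real_inner) set set"
  shows "openin grassmann_topology U \<longleftrightarrow>
     U \<subseteq> grassmann \<and> openin stiefel_topology {x \<in> stiefel. gr_class x \<in> U}"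
proof -
  let ?L = "\<lambda>U :: ((real, 'p) vec \<Rightarrow>\<^sub>L 'h) set set.
    U \<subseteq> grassmann \<and> openin stiefel_topology {x \<in> stiefel. gr_class x \<in> U}"
  have int: "?L (S \<inter> T)" if "?L S" "?L T" for S T
  proof -
    have "{x \<in> stiefel. gr_class x \<in> S \<inter> T} =
        {x \<in> stiefel. gr_class x \<in> S} \<inter> {x \<in> stiefel. gr_class x \<in> T}"
      by blast
    moreover have "openin stiefel_topology
        ({x \<in> stiefel. gr_class x \<in> S} \<inter> {x \<in> stiefel. gr_class x \<in> T})"
      by (rule openin_Int) (use that in blast)+
    ultimately show ?thesis
      using that by (simp only: le_infI1)
  qed
  have un: "?L (\<Union>\<K>)" if "\<forall>K\<in>\<K>. ?L K" for \<K>
  proof -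
    have "openin stiefel_topology (\<Union>((\<lambda>K. {x \<in> stiefel. gr_class x \<in> K}) ` \<K>))"
      by (rule openin_Union) (use that in blast)
    moreover have "{x \<in> stiefel. gr_class x \<in> \<Union>\<K>} =
        \<Union>((\<lambda>K. {x \<in> stiefel. gr_class x \<in> K}) ` \<K>)"
      by blast
    moreover have "\<Union>\<K> \<subseteq> grassmann"
      using that by (intro Sup_least) blast
    ultimately show ?thesis
      by (simp only: simp_thms)
  qed
  have "istopology ?L"
    unfolding istopology_def
    by (intro conjI[OF allI allI] allI impI) (fact int, fact un)
  from topology_inverse'[OF this] show ?thesis
    unfolding grassmann_topology_def by (rule fun_cong)
qed

lemma topspace_grassmann_topology:
  "topspace (grassmann_topology :: ((real, 'p::finite) vec \<Rightarrow>\<^sub>L 'h::real_inner) set topology) = grassmann"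
  (is "topspace ?G = _")
proof
  show "topspace ?G \<subseteq> grassmann"
    using openin_topspace[of ?G] unfolding openin_grassmann_topology by (rule conjunct1)
  have "{x :: (real, 'p) vec \<Rightarrow>\<^sub>L 'h. x \<in> stiefel \<and> gr_class x \<in> grassmann} = topspace stiefel_topology"
    by (auto simp: stiefel_topology_def grassmann_def)
  then have "openin ?G grassmann"
    unfolding openin_grassmann_topology by (simp only: openin_topspace subset_refl simp_thms)
  then show "grassmann \<subseteq> topspace ?G"
    by (rule openin_subset)
qed

lemma quotient_map_gr_class:
  "quotient_map
     (stiefel_topology :: ((real, 'p::finite) vec \<Rightarrow>\<^sub>L 'h::real_inner) topology) grassmann_topology gr_class"
proof -
  have "topspace (stiefel_topology :: ((real, 'p) vec \<Rightarrow>\<^sub>L 'h) topology) = stiefel"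
    by (simp add: stiefel_topology_def)
  then show ?thesis
    by (simp add: quotient_map_def topspace_grassmann_topology openin_grassmann_topology grassmann_def)
qed

text \<open>
  The standard atlas of the quotient \<open>St(p,H) / O(p)\<close>: for each frame \<open>x\<close>, the space of linear maps
  \<open>a\<close> from \<open>real^'p\<close> to the orthogonal complement of \<open>range x\<close> (that is, \<open>x\<^sup>t \<circ> a = 0\<close>)
  parametrizes the open set of all \<open>p\<close>-dimensional subspaces on which \<open>x\<^sup>t\<close> is bijective:
  \<open>a\<close> corresponds to the class of the orthonormal frames of \<open>range (x + a)\<close>.
\<close>

definition gr_model ::
    "((real, 'p::finite) vec \<Rightarrow>\<^sub>L 'h::real_inner) \<Rightarrow> ((real, 'p) vec \<Rightarrow>\<^sub>L 'h) set" where
  "gr_model x = {a. adjoint (blinfun_apply x) \<circ> blinfun_apply a = (\<lambda>_. 0)}"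

definition gr_param ::
    "((real, 'p::finite) vec \<Rightarrow>\<^sub>L 'h::real_inner) \<Rightarrow> ((real, 'p) vec \<Rightarrow>\<^sub>L 'h)
      \<Rightarrow> ((real, 'p) vec \<Rightarrow>\<^sub>L 'h) set" where
  "gr_param x a = {y \<in> stiefel. range (blinfun_apply y) = range (blinfun_apply (x + a))}"

text \<open>
  A self-map of the Grassmann manifold is smooth if around every point it is represented, in a
  chart at that point and a chart at its image, by a smooth map \<open>f\<close>.
\<close>

definition grassmann_smooth ::
    "(((real, 'p::finite) vec \<Rightarrow>\<^sub>L 'h::real_inner) set \<Rightarrow> ((real, 'p) vec \<Rightarrow>\<^sub>L 'h) set) \<Rightarrow> bool" where
  "grassmann_smooth F \<longleftrightarrow>
     (\<forall>V\<in>grassmann. \<exists>x\<in>stiefel. \<exists>y\<in>stiefel. \<exists>D f.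
        openin (top_of_set (gr_model x)) D \<and> V \<in> gr_param x ` D \<and>
        f ` D \<subseteq> gr_model y \<and> smooth_on_subset D f \<and>
        (\<forall>a\<in>D. F (gr_param x a) = gr_param y (f a)))"

definition grassmann_diffeos ::
    "(((real, 'p::finite) vec \<Rightarrow>\<^sub>L 'h::real_inner) set \<Rightarrow> ((real, 'p) vec \<Rightarrow>\<^sub>L 'h) set) set" where
  "grassmann_diffeos = {F. bij_betw F grassmann grassmann \<and>
     grassmann_smooth F \<and> grassmann_smooth (inv_into grassmann F)}"


section \<open>Actions\<close>

text \<open>
  The manifold enters through its underlying topological space \<open>M\<close> and its set \<open>Diff\<close> of
  diffeomorphisms.
\<close>

definition properly_discontinuous_action ::
    "('a, 'b) monoid_scheme \<Rightarrow> 'm topology \<Rightarrow> ('m \<Rightarrow> 'm) set \<Rightarrow> ('a \<Rightarrow> 'm \<Rightarrow> 'm) \<Rightarrow> bool" where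
  "properly_discontinuous_action \<Gamma> M Diff \<phi> \<longleftrightarrow>
     group_action \<Gamma> (topspace M) \<phi> \<and>
     (\<forall>g\<in>carrier \<Gamma>. \<phi> g \<in> Diff) \<and>
     (\<forall>x\<in>topspace M. \<exists>U. openin M U \<and> x \<in> U \<and>
        (\<forall>g\<in>carrier \<Gamma>. g \<noteq> \<one>\<^bsub>\<Gamma>\<^esub> \<longrightarrow> \<phi> g ` U \<inter> U = {})) \<and>
     (\<forall>x\<in>topspace M. \<forall>y\<in>topspace M. y \<notin> orbit \<Gamma> \<phi> x \<longrightarrow>
        (\<exists>U V. openin M U \<and> x \<in> U \<and> openin M V \<and> y \<in> V \<and>
           (\<forall>g\<in>carrier \<Gamma>. \<phi> g ` U \<inter> V = {})))"

definition linear_isometric_action ::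
    "('a, 'b) monoid_scheme \<Rightarrow> ('a \<Rightarrow> 'h::real_inner \<Rightarrow> 'h) \<Rightarrow> bool" where
  "linear_isometric_action \<Gamma> \<rho> \<longleftrightarrow>
     group_action \<Gamma> UNIV \<rho> \<and>
     (\<forall>g\<in>carrier \<Gamma>. linear (\<rho> g) \<and> (\<forall>v. norm (\<rho> g v) = norm v))"

text \<open>The restriction to \<open>stiefel\<close> is needed because \<^const>\<open>group_action\<close> requires
  extensional bijections.\<close>

definition induced_stiefel_action ::
    "('a \<Rightarrow> 'h::real_inner \<Rightarrow> 'h) \<Rightarrow>
      'a \<Rightarrow> ((real, 'p::finite) vec \<Rightarrow>\<^sub>L 'h) \<Rightarrow> ((real, 'p) vec \<Rightarrow>\<^sub>L 'h)" where
  "induced_stiefel_action \<rho> g = (\<lambda>x\<in>stiefel. Blinfun (\<rho> g \<circ> blinfun_apply x))"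

end

theory Submission
  imports Defs "HOL-Number_Theory.Cong"
begin

text \<open>
  Let \<open>G\<close> act on \<open>\<ell>\<^sup>2(G; \<complex>)\<close>, a real Hilbert space of the same dimension as the given one, by
  translations. All matrix coefficients \<open>\<langle>g v, w\<rangle>\<close> tend to \<open>0\<close> as \<open>g\<close> leaves finite sets. Hence
  all but finitely many elements move a given frame, or any frame of the same subspace, far away
  from another given one, and proper discontinuity reduces to freeness. An element of infinite
  order fixes no frame and no finite-dimensional subspace, because its powers would be recurrent.
  If the primes are distinct, then the product of the cyclic groups has a faithful character, and
  multiplying the translations by it makes the torsion elements act without fixed vectors.

  Conversely, if a prime \<open>q\<close> is repeated, then \<open>\<int>\<^sub>q \<times> \<int>\<^sub>q\<close> embeds into the group. Averaging over its
  cyclic subgroups shows that the fixed spaces of finitely many nontrivial elements span the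
  Hilbert space, so one of them is infinite-dimensional and contains a \<open>p\<close>-frame.
\<close>


subsection \<open>Linear isometries\<close>

text \<open>The Hilbert space is only real, so twisting by a complex character needs a complex
  structure. It comes from the cardinality hypothesis: an infinite basis forces \<open>G\<close> to
  be infinite, so the basis can be indexed by two copies of \<open>G\<close>, playing the roles of
  delta_x and i delta_x in complex l^2(G). Both conditions of proper discontinuity are separation
  statements of one shape: a point from itself under the nontrivial elements, and from another point
  under all elements. Outside a finite set of elements the distance is at least 1; the remaining
  elements contribute a minimum of finitely many positive distances. As the elements act by
  isometries, a separation of points spreads to balls of half that size. For subspaces the bound has
  to be uniform over all frames of one of them, which is why the separation lemma speaks of a set of
  frames. A torsion element of \<open>H\<close> has trivial component in the torsion-free
  \<open>G\<close>, so it acts as a complex scalar of modulus 1; faithfulness of the character says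
  that this scalar is not 1.\<close>

definition linear_isometry :: "('a::real_normed_vector \<Rightarrow> 'b::real_normed_vector) \<Rightarrow> bool" where
  "linear_isometry T \<longleftrightarrow> linear T \<and> (\<forall>v. norm (T v) = norm v)"

lemma linear_isometry_linear: "linear_isometry T \<Longrightarrow> linear T"
  by (simp add: linear_isometry_def)

lemma linear_isometry_norm: "linear_isometry T \<Longrightarrow> norm (T v) = norm v"
  by (simp add: linear_isometry_def)

lemma linear_isometry_bounded_linear:
  assumes "linear_isometry T"
  shows "bounded_linear T"
  using assms unfolding linear_isometry_def
  by (intro linear_conv_bounded_linear[THEN iffD2] bounded_linear_intro[where K=1])
    (auto simp: linear_add linear_scale)

lemma linear_isometry_inner:
  fixes T :: "'a::real_inner \<Rightarrow> 'b::real_inner"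
  assumes "linear_isometry T"
  shows "T v \<bullet> T w = v \<bullet> w"
proof -
  have "norm (T v + T w) = norm (v + w)"
    using assms by (metis linear_add linear_isometry_def)
  then show ?thesis
    using assms by (simp add: dot_norm linear_isometry_norm)
qed

lemma linear_isometry_inj: "linear_isometry T \<Longrightarrow> inj T"
  by (metis linear_injective_0 linear_isometry_def norm_eq_zero)

lemma linear_isometry_compose:
  "linear_isometry S \<Longrightarrow> linear_isometry T \<Longrightarrow> linear_isometry (S \<circ> T)"
  by (auto simp: linear_isometry_def linear_compose)

lemma linear_isometry_blinfun_apply_Blinfun:
  "linear_isometry T \<Longrightarrow> blinfun_apply (Blinfun T) = T"
  by (simp add: bounded_linear_Blinfun_apply linear_isometry_bounded_linear)


subsection \<open>Hilbert bases\<close>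

text \<open>Serves as an induction principle: a property that defines a closed subspace has to be
  checked on \<open>B\<close> only.\<close>

lemma closed_subspace_hilbert_basis_UNIV:
  assumes "hilbert_basis B" and "subspace S" and "closed S" and "B \<subseteq> S"
  shows "S = UNIV"
proof -
  have "closure (span B) \<subseteq> S"
    using assms by (intro closure_minimal span_minimal) auto
  then show ?thesis
    using assms by (auto simp: hilbert_basis_def)
qed

lemma bounded_linear_eq_on_hilbert_basis:
  assumes "hilbert_basis B" and S: "bounded_linear S" and T: "bounded_linear T"
    and eq: "\<And>b. b \<in> B \<Longrightarrow> S b = T b"
  shows "S = T"
proof -
  have ST: "bounded_linear (\<lambda>v. S v - T v)"
    using S T by (rule bounded_linear_sub)
  have "{v. S v - T v = 0} = UNIV"
  proof (rule closed_subspace_hilbert_basis_UNIV[OF assms(1)])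
    show "subspace {v. S v - T v = 0}"
      using ST by (intro linear_subspace_kernel bounded_linear.linear)
    show "closed {v. S v - T v = 0}"
      using bounded_linear.continuous_on[OF ST continuous_on_id]
      by (intro closed_Collect_eq) auto
  qed (use eq in auto)
  then show ?thesis
    by auto
qed

lemma hilbert_basis_inner:
  "hilbert_basis B \<Longrightarrow> b \<in> B \<Longrightarrow> c \<in> B \<Longrightarrow> b \<bullet> c = (if b = c then 1 else 0)"
  by (auto simp: hilbert_basis_def pairwise_def orthogonal_def norm_eq_1)

text \<open>Norm preservation makes \<open>f\<close> uniformly continuous on the dense subspace, so
  completeness of the target gives a continuous extension. Additivity, homogeneity and norm
  preservation are closed conditions and pass to the closure.\<close>

lemma extension_linear_isometry:
  fixes f :: "'h::real_normed_vector \<Rightarrow> 'k::{real_normed_vector, complete_space}"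
  assumes lin: "linear f" and iso: "\<And>v. v \<in> S \<Longrightarrow> norm (f v) = norm v"
    and sub: "subspace S" and dense: "closure S = UNIV"
  obtains T where "linear_isometry T" and "\<And>v. v \<in> S \<Longrightarrow> T v = f v"
proof -
  have "uniformly_continuous_on S f"
    unfolding uniformly_continuous_on_def
    by (metis dist_norm iso lin linear_diff sub subspace_diff)
  then obtain T where uT: "uniformly_continuous_on (closure S) T"
    and T: "\<And>v. v \<in> S \<Longrightarrow> f v = T v"
    by (rule uniformly_continuous_on_extension_on_closure) blast
  have cT: "continuous_on UNIV T"
    using uT dense by (simp add: uniformly_continuous_imp_continuous)
  note [continuous_intros] = continuous_on_compose2[OF cT]
  have "T (v + w) = T v + T w" for v w
  proof -
    have "closure (S \<times> S) \<subseteq> {z. T (fst z + snd z) = T (fst z) + T (snd z)}"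
    proof (rule closure_minimal)
      show "S \<times> S \<subseteq> {z. T (fst z + snd z) = T (fst z) + T (snd z)}"
        using lin sub by (auto simp: T[symmetric] linear_add subspace_add)
      show "closed {z. T (fst z + snd z) = T (fst z) + T (snd z)}"
        by (intro closed_Collect_eq continuous_intros) auto
    qed
    then have "(v, w) \<in> {z. T (fst z + snd z) = T (fst z) + T (snd z)}"
      unfolding closure_Times dense by blast
    then show ?thesis
      by simp
  qed
  moreover have "T (c *\<^sub>R v) = c *\<^sub>R T v" for c v
  proof -
    have "closure S \<subseteq> {v. T (c *\<^sub>R v) = c *\<^sub>R T v}"
    proof (rule closure_minimal)
      show "S \<subseteq> {v. T (c *\<^sub>R v) = c *\<^sub>R T v}"
        using lin sub by (auto simp: T[symmetric] linear_scale subspace_scale)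
      show "closed {v. T (c *\<^sub>R v) = c *\<^sub>R T v}"
        by (intro closed_Collect_eq continuous_intros cT) auto
    qed
    then show ?thesis
      unfolding dense by blast
  qed
  moreover have "norm (T v) = norm v" for v
  proof -
    have "closure S \<subseteq> {v. norm (T v) = norm v}"
    proof (rule closure_minimal)
      show "S \<subseteq> {v. norm (T v) = norm v}"
        by (auto simp: T[symmetric] iso)
      show "closed {v. norm (T v) = norm v}"
        by (intro closed_Collect_eq continuous_intros cT) auto
    qed
    then show ?thesis
      unfolding dense by blast
  qed
  ultimately have "linear_isometry T"
    by (auto simp: linear_isometry_def intro!: linearI)
  then show thesis
    using T by (intro that) auto
qed

lemma orthonormal_family_extends:
  fixes f :: "'h::real_inner \<Rightarrow> 'k::{real_inner, complete_space}"
  assumes B: "hilbert_basis B"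
    and f: "\<And>b c. b \<in> B \<Longrightarrow> c \<in> B \<Longrightarrow> f b \<bullet> f c = (if b = c then 1 else 0)"
  shows "\<exists>T. linear_isometry T \<and> (\<forall>b\<in>B. T b = f b)"
proof -
  have "independent B"
    using B by (intro pairwise_orthogonal_independent) (auto simp: hilbert_basis_def)
  \<comment> \<open>This algebraic extension is arbitrary off \<open>span B\<close> and may be
    discontinuous there; only its restriction to \<open>span B\<close> matters.\<close>
  from linear_independent_extend[OF this, of f]
  obtain g where g: "linear g" "\<And>b. b \<in> B \<Longrightarrow> g b = f b"
    by blast
  have *: "g v \<bullet> g w = v \<bullet> w" if "v \<in> span B" "w \<in> span B" for v w
  proof -
    have 1: "g b \<bullet> g w = b \<bullet> w" if "b \<in> B" for b
      using \<open>w \<in> span B\<close>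
    proof (induction w rule: span_induct)
      case base
      show ?case
        by (rule subspaceI) (simp_all add: g linear_0 linear_add linear_scale inner_add_right)
    next
      case (step c)
      then show ?case
        using that by (simp add: g f hilbert_basis_inner[OF B])
    qed
    show ?thesis
      using \<open>v \<in> span B\<close>
    proof (induction v rule: span_induct)
      case base
      show ?case
        by (rule subspaceI) (simp_all add: g linear_0 linear_add linear_scale inner_add_left)
    qed (use 1 in auto)
  qed
  then have "norm (g v) = norm v" if "v \<in> span B" for v
    using that by (simp add: norm_eq_sqrt_inner)
  moreover have "closure (span B) = UNIV"
    using B by (simp add: hilbert_basis_def)
  ultimately obtain T where "linear_isometry T" "\<And>v. v \<in> span B \<Longrightarrow> T v = g v"
    by (rule extension_linear_isometry[OF g(1) _ subspace_span]) auto
  then show ?thesis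
    by (metis g(2) span_base)
qed

text \<open>For finite \<open>B\<close> the Fourier sum is a bounded linear map that fixes
  \<open>B\<close>, hence it is the identity, and \<open>B\<close> would span algebraically.\<close>

lemma infinite_hilbert_basis:
  fixes B :: "'h::real_inner set"
  assumes inf: "infinite_dimensional TYPE('h)" and B: "hilbert_basis B"
  shows "infinite B"
proof
  assume fin: "finite B"
  have "bounded_linear (\<lambda>v. \<Sum>c\<in>B. (v \<bullet> c) *\<^sub>R c)"
    by (intro bounded_linear_sum bounded_linear_compose[OF bounded_linear_scaleR_left]
        bounded_linear_inner_left)
  then have "(\<lambda>v. \<Sum>c\<in>B. (v \<bullet> c) *\<^sub>R c) = (\<lambda>v. v)"
  proof (rule bounded_linear_eq_on_hilbert_basis[OF B _ bounded_linear_ident])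
    fix b assume "b \<in> B"
    then have "(\<Sum>c\<in>B. (b \<bullet> c) *\<^sub>R c) = (\<Sum>c\<in>B. if c = b then b else 0)"
      by (intro sum.cong) (auto simp: hilbert_basis_inner[OF B])
    then show "(\<Sum>c\<in>B. (b \<bullet> c) *\<^sub>R c) = b"
      using fin \<open>b \<in> B\<close> by (simp add: sum.delta)
  qed
  moreover have "(\<Sum>c\<in>B. (v \<bullet> c) *\<^sub>R c) \<in> span B" for v
    by (intro span_sum span_scale span_base)
  ultimately have "v \<in> span B" for v
    by (metis (no_types, lifting))
  then have "span B = UNIV"
    by auto
  then show False
    using fin inf by (auto simp: infinite_dimensional_def)
qed


subsection \<open>Orthonormal frames\<close>

lemma linear_vec_expansion:
  fixes f :: "(real, 'p::finite) vec \<Rightarrow> 'h::real_vector"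
  assumes "linear f"
  shows "f v = (\<Sum>i\<in>UNIV. v $ i *\<^sub>R f (axis i 1))"
proof -
  have "f v = f (\<Sum>i\<in>UNIV. v $ i *\<^sub>R axis i 1)"
    using basis_expansion[of v] by (simp add: scalar_mult_eq_scaleR)
  then show ?thesis
    using assms by (simp add: linear_sum linear_scale)
qed

text \<open>\<open>adjoint\<close> is defined by a choice, so its defining identity depends on the
  existence of some adjoint. The coordinate formula supplies one, because the domain is
  finite-dimensional.\<close>

lemma inner_blinfun_adjoint:
  fixes x :: "(real, 'p::finite) vec \<Rightarrow>\<^sub>L 'h::real_inner"
  shows "v \<bullet> adjoint (blinfun_apply x) w = blinfun_apply x v \<bullet> w"
proof -
  have "adjoint (blinfun_apply x) = (\<lambda>w. \<chi> i. blinfun_apply x (axis i 1) \<bullet> w)"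
  proof (rule adjoint_unique, intro allI)
    fix v w
    show "blinfun_apply x v \<bullet> w = v \<bullet> (\<chi> i. blinfun_apply x (axis i 1) \<bullet> w)"
      by (subst linear_vec_expansion[OF bounded_linear.linear[OF blinfun.bounded_linear_right]])
        (simp add: inner_vec_def inner_sum_left)
  qed
  then show ?thesis
    by (subst linear_vec_expansion[OF bounded_linear.linear[OF blinfun.bounded_linear_right]])
      (simp add: inner_vec_def inner_sum_left)
qed

lemma stiefel_iff_linear_isometry: "x \<in> stiefel \<longleftrightarrow> linear_isometry (blinfun_apply x)"
proof
  assume x: "x \<in> stiefel"
  have "blinfun_apply x v \<bullet> blinfun_apply x v = v \<bullet> v" for v
    using x inner_blinfun_adjoint[of v x "blinfun_apply x v"] unfolding stiefel_def
    by (metis (mono_tags, lifting) comp_apply id_apply mem_Collect_eq)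
  then show "linear_isometry (blinfun_apply x)"
    by (simp add: linear_isometry_def norm_eq_sqrt_inner bounded_linear.linear
        blinfun.bounded_linear_right)
next
  assume "linear_isometry (blinfun_apply x)"
  then have "\<forall>v. v \<bullet> adjoint (blinfun_apply x) (blinfun_apply x w) = v \<bullet> w" for w
    by (simp add: inner_blinfun_adjoint linear_isometry_inner)
  then have "adjoint (blinfun_apply x) (blinfun_apply x w) = w" for w
    by (simp only: vector_eq_ldot)
  then show "x \<in> stiefel"
    by (simp add: stiefel_def fun_eq_iff)
qed

lemma stiefel_inner: "x \<in> stiefel \<Longrightarrow> blinfun_apply x v \<bullet> blinfun_apply x w = v \<bullet> w"
  by (simp add: stiefel_iff_linear_isometry linear_isometry_inner)

lemma stiefel_norm: "x \<in> stiefel \<Longrightarrow> norm (blinfun_apply x v) = norm v"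
  by (simp add: stiefel_iff_linear_isometry linear_isometry_norm)

text \<open>Reduces estimates for arbitrary vectors of a \<open>p\<close>-dimensional subspace to
  the \<open>p\<close> vectors of one frame.\<close>

lemma stiefel_range_expansion:
  fixes x :: "(real, 'p::finite) vec \<Rightarrow>\<^sub>L 'h::real_inner"
  assumes x: "x \<in> stiefel" and w: "w \<in> range (blinfun_apply x)"
  shows "w = (\<Sum>i\<in>UNIV. (w \<bullet> blinfun_apply x (axis i 1)) *\<^sub>R blinfun_apply x (axis i 1))"
proof -
  obtain v where v: "w = blinfun_apply x v"
    using w by blast
  then have "w \<bullet> blinfun_apply x (axis i 1) = v $ i" for i
    using x by (simp add: stiefel_inner inner_axis)
  then show ?thesis
    unfolding v
    by (subst linear_vec_expansion[OF bounded_linear.linear[OF blinfun.bounded_linear_right]]) simp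
qed

lemma orthonormal_family_in_stiefel:
  fixes e :: "'p::finite \<Rightarrow> 'h::real_inner"
  assumes "\<And>i j. e i \<bullet> e j = (if i = j then 1 else 0)"
  obtains x :: "(real, 'p) vec \<Rightarrow>\<^sub>L 'h"
    where "x \<in> stiefel" and "range (blinfun_apply x) = span (range e)"
proof -
  define f where "f v = (\<Sum>i\<in>UNIV. v $ i *\<^sub>R e i)" for v :: "real^'p"
  have f: "bounded_linear f"
    unfolding f_def
    by (intro bounded_linear_sum bounded_linear_compose[OF bounded_linear_scaleR_left]
        bounded_linear_vec_nth)
  have "f v \<bullet> f v = v \<bullet> v" for v
    by (simp add: f_def inner_sum_left inner_sum_right assms inner_vec_def if_distrib
        sum.delta cong: if_cong)
  then have "linear_isometry f"
    using f by (simp add: linear_isometry_def norm_eq_sqrt_inner bounded_linear.linear)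
  then have "Blinfun f \<in> stiefel"
    by (simp add: stiefel_iff_linear_isometry linear_isometry_blinfun_apply_Blinfun)
  moreover have "range f = span (range e)"
  proof
    show "range f \<subseteq> span (range e)"
      unfolding f_def by (intro image_subsetI span_sum span_scale span_base rangeI)
    have "e i = f (axis i 1)" for i
      by (simp add: f_def axis_def if_distrib[of "\<lambda>c. c *\<^sub>R _"] sum.delta cong: if_cong)
    then show "span (range e) \<subseteq> range f"
      using f by (intro span_minimal linear_subspace_image subspace_UNIV bounded_linear.linear) auto
  qed
  ultimately show thesis
    using f that[of "Blinfun f"] by (simp add: bounded_linear_Blinfun_apply)
qed

lemma orthonormal_set_in_stiefel:
  fixes E :: "'h::real_inner set"
  assumes "finite E" and card: "card E = CARD('p::finite)"
    and "pairwise orthogonal E" and "\<And>e. e \<in> E \<Longrightarrow> norm e = 1"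
  obtains x :: "(real, 'p::finite) vec \<Rightarrow>\<^sub>L 'h"
    where "x \<in> stiefel" and "range (blinfun_apply x) = span E"
proof -
  obtain e :: "'p \<Rightarrow> 'h" where e: "bij_betw e UNIV E"
    using assms finite_same_card_bij[of "UNIV :: 'p set" E] by auto
  have "e i \<bullet> e j = (if i = j then 1 else 0)" for i j
  proof -
    have "e i \<in> E" "e j \<in> E" "e i = e j \<longleftrightarrow> i = j"
      using e by (auto simp: bij_betw_def inj_eq)
    then show ?thesis
      using assms by (auto simp: pairwise_def orthogonal_def norm_eq_1)
  qed
  then obtain x :: "(real, 'p) vec \<Rightarrow>\<^sub>L 'h"
    where "x \<in> stiefel" "range (blinfun_apply x) = span (range e)"
    by (rule orthonormal_family_in_stiefel)
  moreover have "range e = E"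
    using e by (rule bij_betw_imp_surj_on)
  ultimately show thesis
    using that by simp
qed

text \<open>Orthogonalization of the image of the standard basis. It is needed because the maps
  \<open>x + a\<close> in the charts of the Grassmannian are in general not isometric.\<close>

lemma injective_range_in_stiefel:
  fixes T :: "(real, 'p::finite) vec \<Rightarrow> 'h::real_inner"
  assumes T: "linear T" "inj T"
  obtains x :: "(real, 'p::finite) vec \<Rightarrow>\<^sub>L 'h"
    where "x \<in> stiefel" and "range (blinfun_apply x) = range T"
proof -
  have "range T = T ` span Basis"
    by simp
  also have "\<dots> = span (T ` Basis)"
    using T(1) by (metis linear_span_image)
  finally have rT: "range T = span (T ` Basis)" .
  obtain C where C: "finite C" "card C \<le> card (T ` Basis)" "span C = span (T ` Basis)"
    "pairwise orthogonal C"
    using basis_orthogonal[of "T ` Basis"] by auto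
  have "independent (T ` Basis)"
    by (rule linear_independent_injective_image[OF T(1) independent_Basis])
      (use T(2) in \<open>auto intro: inj_on_subset\<close>)
  moreover have cT: "card (T ` Basis) = CARD('p)"
    using T(2) by (subst card_image) (auto intro: inj_on_subset)
  ultimately have dim: "dim (range T) = CARD('p)"
    by (simp add: rT dim_eq_card_independent)
  \<comment> \<open>\<open>C\<close> may contain the zero vector, which cannot be normalized. The
    number of remaining vectors is recovered from the dimension of the range.\<close>
  define E where "E = (\<lambda>c. c /\<^sub>R norm c) ` (C - {0})"
  have spE: "span E = range T"
  proof
    show "span E \<subseteq> range T"
      unfolding rT C(3)[symmetric] E_def
      by (intro span_minimal subspace_span) (auto intro: span_scale span_base)
    have "c \<in> span E" if "c \<in> C" for c
    proof (cases "c = 0")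
      case False
      then have "c /\<^sub>R norm c \<in> E"
        using that by (auto simp: E_def)
      then have "norm c *\<^sub>R (c /\<^sub>R norm c) \<in> span E"
        by (intro span_scale span_base)
      then show ?thesis
        using False by simp
    qed (simp add: span_zero)
    then show "range T \<subseteq> span E"
      unfolding rT C(3)[symmetric] by (intro span_minimal subspace_span) auto
  qed
  have orth: "pairwise orthogonal E"
    using C(4) unfolding E_def pairwise_def
    by (auto simp: orthogonal_def)
  have n1: "norm e = 1" if "e \<in> E" for e
    using that by (auto simp: E_def divide_simps split: if_splits)
  then have "0 \<notin> E"
    by (metis norm_zero zero_neq_one)
  then have "independent E"
    using orth by (intro pairwise_orthogonal_independent)
  then have "card E = CARD('p)"
    using dim by (simp add: spE[symmetric] dim_eq_card_independent)
  moreover have "finite E"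
    using C(1) by (simp add: E_def)
  ultimately obtain x :: "(real, 'p) vec \<Rightarrow>\<^sub>L 'h"
    where "x \<in> stiefel" "range (blinfun_apply x) = span E"
    using orth n1 by (rule_tac orthonormal_set_in_stiefel[of E])
  then show thesis
    using that spE by simp
qed

text \<open>One Gram-Schmidt step per induction step: no finite set spans \<open>S\<close>, so a
  vector outside the span of those already found is always available.\<close>

lemma orthonormal_set_in_infinite_dimensional_subspace:
  fixes S :: "'h::real_inner set"
  assumes S: "subspace S" and inf: "\<And>E. finite E \<Longrightarrow> \<not> S \<subseteq> span E"
  shows "\<exists>E\<subseteq>S. finite E \<and> card E = n \<and> pairwise orthogonal E \<and> (\<forall>e\<in>E. norm e = 1)"
proof (induction n)
  case (Suc n)
  then obtain E where E: "E \<subseteq> S" "finite E" "card E = n" "pairwise orthogonal E"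
    "\<And>e. e \<in> E \<Longrightarrow> norm e = 1"
    by blast
  obtain v where v: "v \<in> S" "v \<notin> span E"
    using inf[OF E(2)] by blast
  define u where "u = v - (\<Sum>e\<in>E. (v \<bullet> e) *\<^sub>R e)"
  have "(\<Sum>e\<in>E. (v \<bullet> e) *\<^sub>R e) \<in> span E"
    by (intro span_sum span_scale span_base)
  moreover from this have "(\<Sum>e\<in>E. (v \<bullet> e) *\<^sub>R e) \<in> S"
    using E(1) S by (meson in_mono span_minimal)
  ultimately have u: "u \<in> S" "u \<noteq> 0"
    using v S by (auto simp: u_def subspace_diff)
  have orth: "u \<bullet> e = 0" if "e \<in> E" for e
  proof -
    have "(\<Sum>c\<in>E. (v \<bullet> c) * (c \<bullet> e)) = (\<Sum>c\<in>E. if c = e then v \<bullet> e else 0)"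
      using E(4,5) that
      by (intro sum.cong) (auto simp: pairwise_def orthogonal_def norm_eq_1)
    then show ?thesis
      using E(2) that by (simp add: u_def inner_diff_left inner_sum_left)
  qed
  define w where "w = u /\<^sub>R norm u"
  have w: "w \<in> S" "norm w = 1" "\<And>e. e \<in> E \<Longrightarrow> w \<bullet> e = 0"
    using u orth S by (auto simp: w_def subspace_scale)
  then have orthE: "\<And>e. e \<in> E \<Longrightarrow> orthogonal w e"
    by (simp add: orthogonal_def)
  from w have "w \<notin> E"
    using E(5) by (metis norm_eq_1 zero_neq_one)
  then show ?case
    using E w(1,2) orthE by (intro exI[of _ "insert w E"])
      (auto simp: pairwise_insert orthogonal_commute)
qed (intro exI[of _ "{}"], auto)


subsection \<open>Group actions\<close>

text \<open>The definition asks for a homomorphism into the group of extensional bijections;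
  bijectivity comes for free, with the action of the inverse element as inverse map.\<close>

lemma group_actionI:
  assumes "group \<Gamma>"
    and ext: "\<And>g. g \<in> carrier \<Gamma> \<Longrightarrow> \<phi> g \<in> extensional M"
    and maps: "\<And>g x. g \<in> carrier \<Gamma> \<Longrightarrow> x \<in> M \<Longrightarrow> \<phi> g x \<in> M"
    and one: "\<And>x. x \<in> M \<Longrightarrow> \<phi> \<one>\<^bsub>\<Gamma>\<^esub> x = x"
    and mult: "\<And>g h x. g \<in> carrier \<Gamma> \<Longrightarrow> h \<in> carrier \<Gamma> \<Longrightarrow> x \<in> M \<Longrightarrow>
      \<phi> (g \<otimes>\<^bsub>\<Gamma>\<^esub> h) x = \<phi> g (\<phi> h x)"
  shows "group_action \<Gamma> M \<phi>"
proof -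
  interpret group \<Gamma> by fact
  have inv: "\<phi> (inv\<^bsub>\<Gamma>\<^esub> g) (\<phi> g x) = x" "\<phi> g (\<phi> (inv\<^bsub>\<Gamma>\<^esub> g) x) = x"
    if "g \<in> carrier \<Gamma>" "x \<in> M" for g x
    using that one by (simp_all flip: mult)
  have Bij: "\<phi> g \<in> Bij M" if "g \<in> carrier \<Gamma>" for g
    unfolding Bij_def using that inv ext maps
    by (auto intro!: bij_betw_byWitness[where f'="\<phi> (inv\<^bsub>\<Gamma>\<^esub> g)"])
  have "group_hom \<Gamma> (BijGroup M) \<phi>"
  proof (intro group_hom.intro group_hom_axioms.intro homI)
    fix g h assume "g \<in> carrier \<Gamma>" "h \<in> carrier \<Gamma>"
    then have "\<phi> (g \<otimes>\<^bsub>\<Gamma>\<^esub> h) = compose M (\<phi> g) (\<phi> h)"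
      using ext mult by (intro extensionalityI[where A=M]) (auto simp: compose_def)
    then show "\<phi> (g \<otimes>\<^bsub>\<Gamma>\<^esub> h) = \<phi> g \<otimes>\<^bsub>BijGroup M\<^esub> \<phi> h"
      using \<open>g \<in> carrier \<Gamma>\<close> \<open>h \<in> carrier \<Gamma>\<close> by (simp add: BijGroup_def Bij)
  qed (use Bij in \<open>simp_all add: BijGroup_def group_BijGroup[unfolded BijGroup_def]\<close>)
  then show ?thesis
    by (rule group_action.intro)
qed

text \<open>Turns smoothness of the inverse map of a diffeomorphism into smoothness of the action of
  another group element.\<close>

lemma (in group_action) inv_into_eq:
  assumes "g \<in> carrier G" "x \<in> E"
  shows "inv_into E (\<phi> g) x = \<phi> (inv\<^bsub>G\<^esub> g) x"
proof -
  interpret group G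
    using group_hom by (rule group_hom.axioms(1))
  have "\<phi> (inv\<^bsub>G\<^esub> g) x \<in> E"
    using assms by (intro element_image[OF _ _ refl]) auto
  moreover have "\<phi> g (\<phi> (inv\<^bsub>G\<^esub> g) x) = x"
    using assms orbit_sym_aux[of "inv\<^bsub>G\<^esub> g" x] by simp
  ultimately show ?thesis
    using assms by (intro inv_into_f_eq inj_prop) auto
qed

lemma linear_isometric_actionD:
  assumes "linear_isometric_action \<Gamma> \<rho>"
  shows "group \<Gamma>" and "g \<in> carrier \<Gamma> \<Longrightarrow> linear_isometry (\<rho> g)" and "\<rho> \<one>\<^bsub>\<Gamma>\<^esub> v = v"
    and "g \<in> carrier \<Gamma> \<Longrightarrow> h \<in> carrier \<Gamma> \<Longrightarrow> \<rho> (g \<otimes>\<^bsub>\<Gamma>\<^esub> h) v = \<rho> g (\<rho> h v)"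
proof -
  interpret group_action \<Gamma> UNIV \<rho>
    using assms by (simp add: linear_isometric_action_def)
  show "group \<Gamma>"
    using group_hom by (rule group_hom.axioms(1))
  show "\<rho> \<one>\<^bsub>\<Gamma>\<^esub> v = v"
    using id_eq_one by (metis UNIV_I restrict_apply')
  show "g \<in> carrier \<Gamma> \<Longrightarrow> linear_isometry (\<rho> g)"
    using assms by (simp add: linear_isometric_action_def linear_isometry_def)
  show "g \<in> carrier \<Gamma> \<Longrightarrow> h \<in> carrier \<Gamma> \<Longrightarrow> \<rho> (g \<otimes>\<^bsub>\<Gamma>\<^esub> h) v = \<rho> g (\<rho> h v)"
    by (simp add: composition_rule)
qed

lemma linear_isometric_actionI:
  assumes "group \<Gamma>" and "\<And>g. g \<in> carrier \<Gamma> \<Longrightarrow> linear_isometry (\<rho> g)"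
    and "\<And>v. \<rho> \<one>\<^bsub>\<Gamma>\<^esub> v = v"
    and "\<And>g h v. g \<in> carrier \<Gamma> \<Longrightarrow> h \<in> carrier \<Gamma> \<Longrightarrow> \<rho> (g \<otimes>\<^bsub>\<Gamma>\<^esub> h) v = \<rho> g (\<rho> h v)"
  shows "linear_isometric_action \<Gamma> \<rho>"
  using assms unfolding linear_isometric_action_def
  by (auto intro!: group_actionI simp: linear_isometry_def)

lemma linear_isometric_action_pow:
  assumes "linear_isometric_action \<Gamma> \<rho>" and "g \<in> carrier \<Gamma>"
  shows "\<rho> (g [^]\<^bsub>\<Gamma>\<^esub> (n::nat)) v = (\<rho> g ^^ n) v"
proof (induction n arbitrary: v)
  case 0
  then show ?case
    using assms by (simp add: linear_isometric_actionD)
next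
  case (Suc n)
  interpret group \<Gamma>
    using assms by (simp add: linear_isometric_actionD)
  show ?case
    using assms Suc by (simp add: linear_isometric_actionD(4) funpow_swap1)
qed


subsection \<open>Smoothness of bounded linear maps\<close>

text \<open>The first derivative is \<open>f\<close> itself at every point and all higher ones
  vanish, so the remainder in the definition is exactly zero and any \<open>\<delta>\<close>
  works.\<close>

lemma smooth_on_open_bounded_linear:
  assumes f: "bounded_linear f"
  shows "smooth_on_open UNIV f"
proof -
  define D where "D x vs = (case vs of [] \<Rightarrow> f x | [v] \<Rightarrow> f v | _ \<Rightarrow> 0)" for x vs
  obtain K where K: "\<And>v. norm (f v) \<le> norm v * K"
    using bounded_linear.bounded[OF f] by blast
  have lin: "linear (\<lambda>v. D x (us @ v # ws))" for x us ws
  proof (cases "us = [] \<and> ws = []")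
    case True
    then show ?thesis
      using f by (simp add: D_def bounded_linear.linear)
  next
    case False
    then have "(\<lambda>v. D x (us @ v # ws)) = (\<lambda>v. 0)"
      by (auto simp: D_def fun_eq_iff append_eq_Cons_conv split: list.splits)
    then show ?thesis
      by (simp add: linear_zero)
  qed
  have bnd: "\<exists>C. \<forall>vs. length vs = n \<longrightarrow> norm (D x vs) \<le> C * (\<Prod>v\<leftarrow>vs. norm v)" for x n
  proof (intro exI[of _ "if n = 0 then norm (f x) else if n = 1 then K else 0"] allI impI)
    fix vs :: "'a list" assume "length vs = n"
    then show "norm (D x vs) \<le> (if n = 0 then norm (f x) else if n = 1 then K else 0) * (\<Prod>v\<leftarrow>vs. norm v)"
      using K by (auto simp: D_def mult.commute split: list.splits)
  qed
  have "D (x + h) vs - D x vs - D x (h # vs) = 0" for x h vs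
    using f by (auto simp: D_def linear_add bounded_linear.linear split: list.splits)
  then have "\<exists>\<delta>>0. \<forall>h vs. norm h < \<delta> \<and> length vs = n \<longrightarrow>
           norm (D (x + h) vs - D x vs - D x (h # vs)) \<le> \<epsilon> * norm h * (\<Prod>v\<leftarrow>vs. norm v)"
    if "\<epsilon> > 0" for n x \<epsilon>
    using that by (intro exI[of _ 1]) (auto intro!: mult_nonneg_nonneg prod_list_nonneg)
  moreover have "D x [] = f x" for x
    by (simp add: D_def)
  ultimately show ?thesis
    unfolding smooth_on_open_def using lin bnd by (intro conjI exI[of _ D]) auto
qed

lemma smooth_on_subset_bounded_linear:
  assumes "bounded_linear L" and "\<And>x. x \<in> S \<Longrightarrow> f x = L x"
  shows "smooth_on_subset S f"
  unfolding smooth_on_subset_def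
  using assms by (metis Int_iff UNIV_I smooth_on_open_bounded_linear)


subsection \<open>Isometries acting on frames\<close>

lemma Blinfun_comp_blinfun_apply:
  "bounded_linear T \<Longrightarrow> Blinfun (T \<circ> blinfun_apply x) = Blinfun T o\<^sub>L x"
  by (rule blinfun_eqI)
    (simp add: bounded_linear_Blinfun_apply bounded_linear_compose blinfun.bounded_linear_right comp_def)

lemma bounded_linear_blinfun_compose_right: "bounded_linear (\<lambda>x. A o\<^sub>L x)"
  by (rule bounded_bilinear.bounded_linear_right[OF bounded_bilinear_blinfun_compose])

lemma linear_isometry_compose_stiefel:
  "linear_isometry T \<Longrightarrow> x \<in> stiefel \<Longrightarrow> Blinfun T o\<^sub>L x \<in> stiefel"
  by (simp add: stiefel_iff_linear_isometry linear_isometry_blinfun_apply_Blinfun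
      linear_isometry_def linear_compose[unfolded comp_def] bounded_linear.linear
      blinfun.bounded_linear_right)

lemma norm_linear_isometry_compose:
  assumes "linear_isometry T"
  shows "norm (Blinfun T o\<^sub>L x) \<le> norm x"
proof (rule norm_blinfun_bound)
  fix v
  have "norm (T (blinfun_apply x v)) \<le> norm x * norm v"
    using assms by (simp add: linear_isometry_norm norm_blinfun)
  then show "norm (blinfun_apply (Blinfun T o\<^sub>L x) v) \<le> norm x * norm v"
    using assms by (simp add: linear_isometry_blinfun_apply_Blinfun)
qed simp

lemma norm_compose_linear_isometry:
  assumes "linear_isometry T"
  shows "norm (x o\<^sub>L Blinfun T) \<le> norm x"
proof (rule norm_blinfun_bound)
  fix v
  have "norm (blinfun_apply x (T v)) \<le> norm x * norm v"
    using assms by (metis linear_isometry_norm norm_blinfun)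
  then show "norm (blinfun_apply (x o\<^sub>L Blinfun T) v) \<le> norm x * norm v"
    using assms by (simp add: linear_isometry_blinfun_apply_Blinfun)
qed simp

text \<open>Unlike \<open>induced_stiefel_action\<close> this is not cut off outside
  \<open>stiefel\<close>. It is therefore linear on the whole operator space, which gives smoothness
  at once, and it also applies to the chart coordinates of the Grassmannian.\<close>

definition frame_action ::
    "('a \<Rightarrow> 'h::real_inner \<Rightarrow> 'h) \<Rightarrow> 'a \<Rightarrow> ((real, 'p::finite) vec \<Rightarrow>\<^sub>L 'h) \<Rightarrow> ((real, 'p) vec \<Rightarrow>\<^sub>L 'h)"
  where "frame_action \<rho> g x = Blinfun (\<rho> g) o\<^sub>L x"

context
  fixes \<Gamma> :: "('a, 'b) monoid_scheme" and \<rho> :: "'a \<Rightarrow> 'h::real_inner \<Rightarrow> 'h"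
  assumes action: "linear_isometric_action \<Gamma> \<rho>"
begin

lemma frame_action_apply:
  "g \<in> carrier \<Gamma> \<Longrightarrow> blinfun_apply (frame_action \<rho> g x) v = \<rho> g (blinfun_apply x v)"
  using linear_isometric_actionD[OF action]
  by (simp add: frame_action_def linear_isometry_blinfun_apply_Blinfun)

lemma frame_action_eq_Blinfun:
  "g \<in> carrier \<Gamma> \<Longrightarrow> Blinfun (\<rho> g \<circ> blinfun_apply x) = frame_action \<rho> g x"
  using linear_isometric_actionD[OF action]
  by (simp add: frame_action_def Blinfun_comp_blinfun_apply linear_isometry_bounded_linear)

lemma frame_action_one: "frame_action \<rho> \<one>\<^bsub>\<Gamma>\<^esub> x = x"
  using linear_isometric_actionD[OF action]
  by (intro blinfun_eqI) (simp add: frame_action_apply group.is_monoid monoid.one_closed)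

lemma frame_action_mult:
  "g \<in> carrier \<Gamma> \<Longrightarrow> h \<in> carrier \<Gamma> \<Longrightarrow>
    frame_action \<rho> (g \<otimes>\<^bsub>\<Gamma>\<^esub> h) x = frame_action \<rho> g (frame_action \<rho> h x)"
  using linear_isometric_actionD[OF action]
  by (intro blinfun_eqI) (simp add: frame_action_apply group.is_monoid monoid.m_closed)

lemma frame_action_stiefel:
  "g \<in> carrier \<Gamma> \<Longrightarrow> x \<in> stiefel \<Longrightarrow> frame_action \<rho> g x \<in> stiefel"
  using linear_isometric_actionD[OF action]
  by (simp add: frame_action_def linear_isometry_compose_stiefel)

lemma bounded_linear_frame_action: "bounded_linear (frame_action \<rho> g)"
  unfolding frame_action_def by (rule bounded_linear_blinfun_compose_right)

lemma norm_frame_action_diff: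
  assumes "g \<in> carrier \<Gamma>"
  shows "norm (frame_action \<rho> g x - frame_action \<rho> g y) \<le> norm (x - y)"
  using norm_linear_isometry_compose[of "\<rho> g" "x - y"] linear_isometric_actionD(2)[OF action assms]
  by (simp add: frame_action_def blinfun.diff_left bounded_bilinear.diff_right[OF bounded_bilinear_blinfun_compose])

lemma induced_stiefel_action_eq:
  "g \<in> carrier \<Gamma> \<Longrightarrow> x \<in> stiefel \<Longrightarrow> induced_stiefel_action \<rho> g x = frame_action \<rho> g x"
  by (simp add: induced_stiefel_action_def frame_action_eq_Blinfun)

lemma group_action_induced_stiefel_action:
  "group_action \<Gamma> (stiefel :: ((real, 'p::finite) vec \<Rightarrow>\<^sub>L 'h) set) (induced_stiefel_action \<rho>)"
proof (rule group_actionI)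
  show grp: "group \<Gamma>"
    by (rule linear_isometric_actionD[OF action])
  show "induced_stiefel_action \<rho> g \<in> extensional stiefel" for g
    by (simp add: induced_stiefel_action_def)
qed (simp_all add: induced_stiefel_action_eq frame_action_stiefel frame_action_one frame_action_mult
    group.is_monoid monoid.m_closed monoid.one_closed linear_isometric_actionD(1)[OF action])

lemma induced_stiefel_action_diffeo:
  assumes g: "g \<in> carrier \<Gamma>"
  shows "(induced_stiefel_action \<rho> g :: ((real, 'p::finite) vec \<Rightarrow>\<^sub>L 'h) \<Rightarrow> _) \<in> stiefel_diffeos"
proof -
  interpret group_action \<Gamma> "stiefel :: ((real, 'p) vec \<Rightarrow>\<^sub>L 'h) set" "induced_stiefel_action \<rho>"
    by (rule group_action_induced_stiefel_action)
  have ginv: "inv\<^bsub>\<Gamma>\<^esub> g \<in> carrier \<Gamma>"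
    using g linear_isometric_actionD(1)[OF action] by simp
  show ?thesis
    unfolding stiefel_diffeos_def
    using bij_prop0[OF g] g ginv
    by (auto simp: Bij_def inv_into_eq induced_stiefel_action_eq
        intro!: smooth_on_subset_bounded_linear[OF bounded_linear_frame_action])
qed

end


subsection \<open>Mixing actions\<close>

text \<open>Mixing in the sense of representation theory: all matrix coefficients vanish at infinity
  on the discrete group.\<close>

definition mixing :: "('a, 'b) monoid_scheme \<Rightarrow> ('a \<Rightarrow> 'h::real_inner \<Rightarrow> 'h) \<Rightarrow> bool" where
  "mixing \<Gamma> \<rho> \<longleftrightarrow> (\<forall>v w. \<forall>\<epsilon>>0. finite {g \<in> carrier \<Gamma>. \<epsilon> \<le> \<bar>\<rho> g v \<bullet> w\<bar>})"

lemma mixingD: "mixing \<Gamma> \<rho> \<Longrightarrow> \<epsilon> > 0 \<Longrightarrow> finite {g \<in> carrier \<Gamma>. \<epsilon> \<le> \<bar>\<rho> g v \<bullet> w\<bar>}"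
  by (simp add: mixing_def)

lemma (in group) infinite_order_pow_inj:
  assumes "g \<in> carrier G" and "\<And>n::nat. n > 0 \<Longrightarrow> g [^] n \<noteq> \<one>"
  shows "inj (\<lambda>n::nat. g [^] n)"
proof (rule linorder_injI)
  fix m n :: nat assume "m < n"
  then show "g [^] m \<noteq> g [^] n"
    using assms pow_eq_div2[of g n m] by (metis zero_less_diff)
qed

text \<open>The powers of \<open>g\<close> are pairwise distinct, so they cannot all lie in the
  finite union of the exceptional sets; some power makes all the coefficients small at once.\<close>

lemma mixing_no_recurrence:
  assumes "group \<Gamma>" and mix: "mixing \<Gamma> \<rho>" and g: "g \<in> carrier \<Gamma>"
    and inf: "\<And>n::nat. n > 0 \<Longrightarrow> g [^]\<^bsub>\<Gamma>\<^esub> n \<noteq> \<one>\<^bsub>\<Gamma>\<^esub>"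
    and "finite I" and "\<epsilon> > 0"
  shows "\<exists>n::nat. \<forall>i\<in>I. \<bar>\<rho> (g [^]\<^bsub>\<Gamma>\<^esub> n) v \<bullet> w i\<bar> < \<epsilon>"
proof (rule ccontr)
  assume "\<not> ?thesis"
  then have "range (\<lambda>n::nat. g [^]\<^bsub>\<Gamma>\<^esub> n) \<subseteq> (\<Union>i\<in>I. {g \<in> carrier \<Gamma>. \<epsilon> \<le> \<bar>\<rho> g v \<bullet> w i\<bar>})"
    using \<open>group \<Gamma>\<close> g by (auto simp: not_less group.is_monoid monoid.nat_pow_closed)
  moreover have "finite (\<Union>i\<in>I. {g \<in> carrier \<Gamma>. \<epsilon> \<le> \<bar>\<rho> g v \<bullet> w i\<bar>})"
    using \<open>finite I\<close> mix \<open>\<epsilon> > 0\<close> by (auto intro: mixingD)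
  ultimately have "finite (range (\<lambda>n::nat. g [^]\<^bsub>\<Gamma>\<^esub> n))"
    by (rule finite_subset)
  then show False
    using group.infinite_order_pow_inj[OF \<open>group \<Gamma>\<close> g inf] finite_imageD by blast
qed

text \<open>A fixed vector would keep the coefficient of \<open>v\<close> with itself at
  \<open>v \<bullet> v\<close> along all powers of \<open>g\<close>.\<close>

lemma mixing_no_fixed_vector:
  assumes act: "linear_isometric_action \<Gamma> \<rho>" and mix: "mixing \<Gamma> \<rho>" and g: "g \<in> carrier \<Gamma>"
    and inf: "\<And>n::nat. n > 0 \<Longrightarrow> g [^]\<^bsub>\<Gamma>\<^esub> n \<noteq> \<one>\<^bsub>\<Gamma>\<^esub>" and "v \<noteq> 0"
  shows "\<rho> g v \<noteq> v"
proof
  assume "\<rho> g v = v"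
  then have "(\<rho> g ^^ n) v = v" for n
    by (induction n) auto
  moreover have "\<exists>n::nat. \<forall>i\<in>{()}. \<bar>\<rho> (g [^]\<^bsub>\<Gamma>\<^esub> n) v \<bullet> v\<bar> < v \<bullet> v"
    by (rule mixing_no_recurrence[OF linear_isometric_actionD(1)[OF act] mix g inf])
      (use \<open>v \<noteq> 0\<close> in auto)
  ultimately show False
    using act g by (simp add: linear_isometric_action_pow)
qed

text \<open>In an invariant subspace every power of \<open>g\<close> maps a frame vector to a unit
  vector of the subspace, whose coordinates in the frame cannot all be small.\<close>

lemma mixing_no_invariant_frame:
  fixes x :: "(real, 'p::finite) vec \<Rightarrow>\<^sub>L 'h::real_inner"
  assumes act: "linear_isometric_action \<Gamma> \<rho>" and mix: "mixing \<Gamma> \<rho>" and g: "g \<in> carrier \<Gamma>"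
    and inf: "\<And>n::nat. n > 0 \<Longrightarrow> g [^]\<^bsub>\<Gamma>\<^esub> n \<noteq> \<one>\<^bsub>\<Gamma>\<^esub>" and x: "x \<in> stiefel"
  shows "range (blinfun_apply (frame_action \<rho> g x)) \<noteq> range (blinfun_apply x)"
proof
  assume eq: "range (blinfun_apply (frame_action \<rho> g x)) = range (blinfun_apply x)"
  define e where "e i = blinfun_apply x (axis i 1)" for i
  fix i0 :: 'p
  have e: "norm (e i) = 1" "e i \<in> range (blinfun_apply x)" for i
    using x by (simp_all add: e_def stiefel_norm)
  have inv: "\<rho> g w \<in> range (blinfun_apply x)" if w: "w \<in> range (blinfun_apply x)" for w
  proof -
    obtain v where "w = blinfun_apply x v"
      using w by blast
    then have "\<rho> g w = blinfun_apply (frame_action \<rho> g x) v"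
      by (simp add: frame_action_apply[OF act g])
    then show ?thesis
      using eq by blast
  qed
  \<comment> \<open>With \<open>p\<close> coordinates, each below 1/\<open>p\<close> in absolute
    value, the triangle inequality makes the norm smaller than 1.\<close>
  obtain n :: nat where n: "\<forall>i. \<bar>\<rho> (g [^]\<^bsub>\<Gamma>\<^esub> n) (e i0) \<bullet> e i\<bar> < 1 / CARD('p)"
    using mixing_no_recurrence[OF linear_isometric_actionD(1)[OF act] mix g inf finite,
        where I=UNIV and \<epsilon>="1 / CARD('p)" and v="e i0" and w=e] by auto
  define w where "w = \<rho> (g [^]\<^bsub>\<Gamma>\<^esub> n) (e i0)"
  have "g [^]\<^bsub>\<Gamma>\<^esub> n \<in> carrier \<Gamma>"
    using g linear_isometric_actionD(1)[OF act] by (simp add: group.is_monoid monoid.nat_pow_closed)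
  then have nw: "norm w = 1"
    unfolding w_def using linear_isometric_actionD(2)[OF act] by (simp add: linear_isometry_norm e)
  have "(\<rho> g ^^ n) (e i0) \<in> range (blinfun_apply x)"
    using e inv by (induction n) auto
  then have "w \<in> range (blinfun_apply x)"
    using act g by (simp add: w_def linear_isometric_action_pow)
  then have w: "w = (\<Sum>i\<in>UNIV. (w \<bullet> e i) *\<^sub>R e i)"
    unfolding e_def by (rule stiefel_range_expansion[OF x])
  have "norm w \<le> (\<Sum>i\<in>UNIV. norm ((w \<bullet> e i) *\<^sub>R e i))"
    by (subst w) (rule norm_sum)
  also have "\<dots> < (\<Sum>i\<in>(UNIV::'p set). 1 / CARD('p))"
    using n by (intro sum_strict_mono) (auto simp: w_def e)
  also have "\<dots> = 1"
    by simp
  finally show False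
    using nw by simp
qed

text \<open>\<open>X\<close> will be the singleton of \<open>x\<close> on the Stiefel manifold and
  the whole class of \<open>x\<close> on the Grassmannian. The coefficients of the \<open>p\<close>
  vectors of \<open>x\<close> with a single vector of \<open>y\<close> control all frames in
  \<open>X\<close>, so one finite set of exceptional elements serves for all of them.\<close>

lemma mixing_separation:
  fixes x y :: "(real, 'p::finite) vec \<Rightarrow>\<^sub>L 'h::real_inner"
  assumes act: "linear_isometric_action \<Gamma> \<rho>" and mix: "mixing \<Gamma> \<rho>"
    and x: "x \<in> stiefel" and y: "y \<in> stiefel"
    and X: "\<And>z. z \<in> X \<Longrightarrow> z \<in> stiefel"
      "\<And>z. z \<in> X \<Longrightarrow> range (blinfun_apply z) \<subseteq> range (blinfun_apply x)"
    and S: "S \<subseteq> carrier \<Gamma>"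
    and sep: "\<And>g. g \<in> S \<Longrightarrow> \<exists>d>0. \<forall>z\<in>X. d \<le> norm (frame_action \<rho> g z - y)"
  shows "\<exists>d>0. \<forall>g\<in>S. \<forall>z\<in>X. d \<le> norm (frame_action \<rho> g z - y)"
proof -
  fix i0 :: 'p
  define e where "e i = blinfun_apply x (axis i 1)" for i
  define f where "f = blinfun_apply y (axis i0 1)"
  have nf: "norm f = 1"
    using y by (simp add: f_def stiefel_norm)
  \<comment> \<open>The coordinates of a unit vector are at most 1, so \<open>p\<close> terms
    bounded by \<open>\<epsilon>\<close> give an inner product of at most 1/2; two unit vectors with
    such an inner product are at distance at least 1.\<close>
  define \<epsilon> where "\<epsilon> = 1 / (2 * real CARD('p))"
  have "\<epsilon> > 0"
    by (simp add: \<epsilon>_def)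
  define E where "E = (\<Union>i\<in>UNIV. {g \<in> carrier \<Gamma>. \<epsilon> \<le> \<bar>\<rho> g (e i) \<bullet> f\<bar>})"
  have "finite E"
    using \<open>\<epsilon> > 0\<close> mix by (auto simp: E_def intro: mixingD)
  have far: "1 \<le> norm (frame_action \<rho> g z - y)" if "g \<in> S" "g \<notin> E" "z \<in> X" for g z
  proof -
    have g: "g \<in> carrier \<Gamma>"
      using that S by blast
    have iso: "linear_isometry (\<rho> g)"
      by (rule linear_isometric_actionD(2)[OF act g])
    define u where "u = blinfun_apply z (axis i0 1)"
    have nu: "norm u = 1"
      using X that by (simp add: u_def stiefel_norm)
    have "u \<in> range (blinfun_apply x)"
      using X(2)[OF that(3)] by (auto simp: u_def)
    then have u: "u = (\<Sum>i\<in>UNIV. (u \<bullet> e i) *\<^sub>R e i)"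
      unfolding e_def by (rule stiefel_range_expansion[OF x])
    have "\<bar>u \<bullet> e i\<bar> \<le> 1" for i
      using Cauchy_Schwarz_ineq2[of u "e i"] nu x by (simp add: e_def stiefel_norm)
    moreover have "\<bar>\<rho> g (e i) \<bullet> f\<bar> \<le> \<epsilon>" for i
      using that(2) g by (auto simp: E_def not_le intro: less_imp_le)
    ultimately have "\<bar>(u \<bullet> e i) * (\<rho> g (e i) \<bullet> f)\<bar> \<le> \<epsilon>" for i
      using mult_mono[of "\<bar>u \<bullet> e i\<bar>" 1 "\<bar>\<rho> g (e i) \<bullet> f\<bar>" \<epsilon>] by (simp add: abs_mult)
    then have "(\<Sum>i\<in>UNIV. \<bar>(u \<bullet> e i) * (\<rho> g (e i) \<bullet> f)\<bar>) \<le> (\<Sum>i\<in>(UNIV::'p set). \<epsilon>)"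
      by (rule sum_mono)
    also have "\<dots> = 1 / 2"
      by (simp add: \<epsilon>_def)
    finally have sum_le: "(\<Sum>i\<in>UNIV. \<bar>(u \<bullet> e i) * (\<rho> g (e i) \<bullet> f)\<bar>) \<le> 1 / 2" .
    have "\<rho> g u \<bullet> f = (\<Sum>i\<in>UNIV. (u \<bullet> e i) * (\<rho> g (e i) \<bullet> f))"
      using iso by (subst u) (simp add: linear_isometry_def linear_sum linear_scale inner_sum_left)
    also have "\<dots> \<le> (\<Sum>i\<in>UNIV. \<bar>(u \<bullet> e i) * (\<rho> g (e i) \<bullet> f)\<bar>)"
      by (intro sum_mono) simp
    also note sum_le
    finally have "\<rho> g u \<bullet> f \<le> 1 / 2" .
    then have "1\<^sup>2 \<le> (norm (\<rho> g u - f))\<^sup>2"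
      using nf nu by (simp add: dot_norm_neg linear_isometry_norm[OF iso])
    then have "1 \<le> norm (\<rho> g u - f)"
      by (rule power2_le_imp_le) simp
    also have "\<rho> g u - f = blinfun_apply (frame_action \<rho> g z - y) (axis i0 1)"
      by (simp add: blinfun.diff_left frame_action_apply[OF act g] u_def f_def)
    also have "norm \<dots> \<le> norm (frame_action \<rho> g z - y)"
      using norm_blinfun[of "frame_action \<rho> g z - y" "axis i0 1"] by simp
    finally show ?thesis .
  qed
  obtain D where D: "\<And>g. g \<in> S \<Longrightarrow> D g > 0 \<and> (\<forall>z\<in>X. D g \<le> norm (frame_action \<rho> g z - y))"
    using sep by metis
  \<comment> \<open>The inserted 1 is the bound for elements outside \<open>E\<close>, and it keeps
    the set nonempty.\<close>
  define d where "d = Min (insert 1 (D ` (E \<inter> S)))"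
  have "d > 0"
    using \<open>finite E\<close> D by (auto simp: d_def)
  moreover have "d \<le> norm (frame_action \<rho> g z - y)" if "g \<in> S" "z \<in> X" for g z
  proof (cases "g \<in> E")
    case True
    then have "d \<le> D g"
      using \<open>finite E\<close> that by (auto simp: d_def intro: Min_le)
    then show ?thesis
      using D[OF that(1)] that(2) by force
  next
    case False
    have "d \<le> 1"
      using \<open>finite E\<close> by (auto simp: d_def intro: Min_le)
    then show ?thesis
      using far[OF that(1) False that(2)] by simp
  qed
  ultimately show ?thesis
    by blast
qed


subsection \<open>Proper discontinuity on the Stiefel manifold\<close>

text \<open>If the points are separated by \<open>d\<close>, radius \<open>d / 2\<close> works:
  \<open>g\<close> does not increase the distance between \<open>x\<close> and a point of the first
  ball, and the second ball uses up the other half. The set \<open>S\<close> lets one lemma serve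
  both conditions of proper discontinuity.\<close>

lemma mixing_separated_balls_stiefel:
  fixes x y :: "(real, 'p::finite) vec \<Rightarrow>\<^sub>L 'h::real_inner"
  assumes act: "linear_isometric_action \<Gamma> \<rho>" and mix: "mixing \<Gamma> \<rho>"
    and x: "x \<in> stiefel" and y: "y \<in> stiefel"
    and S: "S \<subseteq> carrier \<Gamma>" and ne: "\<And>g. g \<in> S \<Longrightarrow> frame_action \<rho> g x \<noteq> y"
  shows "\<exists>r>0. \<forall>g\<in>S. induced_stiefel_action \<rho> g ` (stiefel \<inter> ball x r) \<inter> (stiefel \<inter> ball y r) = {}"
proof -
  have "\<exists>d>0. \<forall>g\<in>S. \<forall>z\<in>{x}. d \<le> norm (frame_action \<rho> g z - y)"
    by (rule mixing_separation[OF act mix x y _ _ S])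
      (use x ne in \<open>auto intro!: exI[of _ "norm (frame_action \<rho> _ x - y)"]\<close>)
  then obtain d where d: "d > 0" "\<And>g. g \<in> S \<Longrightarrow> d \<le> norm (frame_action \<rho> g x - y)"
    by auto
  have False if "g \<in> S" "z \<in> stiefel" "dist x z < d / 2" "dist y (induced_stiefel_action \<rho> g z) < d / 2" for g z
  proof -
    have g: "g \<in> carrier \<Gamma>"
      using that S by blast
    have "norm (frame_action \<rho> g x - y)
        \<le> norm (frame_action \<rho> g x - frame_action \<rho> g z) + norm (frame_action \<rho> g z - y)"
      by norm
    also have "\<dots> \<le> dist x z + dist y (frame_action \<rho> g z)"
      using norm_frame_action_diff[OF act g, of x z] by (simp add: dist_norm norm_minus_commute)
    also have "\<dots> < d"
      using that(3,4) induced_stiefel_action_eq[OF act g that(2)] by simp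
    finally show False
      using d that by force
  qed
  then show ?thesis
    using d(1) by (intro exI[of _ "d / 2"]) auto
qed

text \<open>Condition (1) separates \<open>x\<close> from itself under the nontrivial elements,
  condition (2) separates \<open>x\<close> from \<open>y\<close> under all elements. A fixed frame
  would consist of fixed unit vectors, which \<open>free\<close> excludes.\<close>

theorem mixing_properly_discontinuous_stiefel:
  assumes act: "linear_isometric_action \<Gamma> \<rho>" and mix: "mixing \<Gamma> \<rho>"
    and free: "\<And>g v. g \<in> carrier \<Gamma> \<Longrightarrow> g \<noteq> \<one>\<^bsub>\<Gamma>\<^esub> \<Longrightarrow> v \<noteq> 0 \<Longrightarrow> \<rho> g v \<noteq> v"
  shows "properly_discontinuous_action \<Gamma>
    (stiefel_topology :: ((real, 'p::finite) vec \<Rightarrow>\<^sub>L 'h::real_inner) topology)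
    stiefel_diffeos (induced_stiefel_action \<rho>)"
proof -
  let ?St = "stiefel :: ((real, 'p) vec \<Rightarrow>\<^sub>L 'h) set"
  have op: "openin stiefel_topology (?St \<inter> ball x r)" for x r
    unfolding stiefel_topology_def by (rule openin_open_Int) simp
  have ts: "topspace stiefel_topology = ?St"
    by (simp add: stiefel_topology_def)
  have ne: "frame_action \<rho> g x \<noteq> x"
    if x: "x \<in> ?St" and g: "g \<in> carrier \<Gamma> - {\<one>\<^bsub>\<Gamma>\<^esub>}" for g x
  proof
    assume eq: "frame_action \<rho> g x = x"
    fix i :: 'p
    have "\<rho> g (blinfun_apply x (axis i 1)) = blinfun_apply x (axis i 1)"
      using eq g frame_action_apply[OF act, of g x "axis i 1"] by simp
    moreover have "norm (blinfun_apply x (axis i 1)) = 1"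
      using x by (simp add: stiefel_norm)
    ultimately show False
      using free g by (metis DiffE insert_iff norm_zero zero_neq_one)
  qed
  have "\<exists>U. openin stiefel_topology U \<and> x \<in> U \<and>
        (\<forall>g\<in>carrier \<Gamma>. g \<noteq> \<one>\<^bsub>\<Gamma>\<^esub> \<longrightarrow> induced_stiefel_action \<rho> g ` U \<inter> U = {})" if x: "x \<in> ?St" for x
  proof -
    obtain r where "r > 0" "\<forall>g\<in>carrier \<Gamma> - {\<one>\<^bsub>\<Gamma>\<^esub>}.
        induced_stiefel_action \<rho> g ` (stiefel \<inter> ball x r) \<inter> (stiefel \<inter> ball x r) = {}"
      using mixing_separated_balls_stiefel[OF act mix x x, of "carrier \<Gamma> - {\<one>\<^bsub>\<Gamma>\<^esub>}"] ne x
      by auto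
    then show ?thesis
      using op x by (intro exI[of _ "?St \<inter> ball x r"]) auto
  qed
  moreover have "\<exists>U V. openin stiefel_topology U \<and> x \<in> U \<and> openin stiefel_topology V \<and> y \<in> V \<and>
        (\<forall>g\<in>carrier \<Gamma>. induced_stiefel_action \<rho> g ` U \<inter> V = {})"
    if "x \<in> ?St" "y \<in> ?St" "y \<notin> orbit \<Gamma> (induced_stiefel_action \<rho>) x" for x y
  proof -
    have "frame_action \<rho> g x \<noteq> y" if "g \<in> carrier \<Gamma>" for g
      using that \<open>y \<notin> _\<close> induced_stiefel_action_eq[OF act that \<open>x \<in> ?St\<close>]
      unfolding orbit_def by (metis (mono_tags, lifting) mem_Collect_eq)
    then obtain r where "r > 0" "\<forall>g\<in>carrier \<Gamma>.
        induced_stiefel_action \<rho> g ` (stiefel \<inter> ball x r) \<inter> (stiefel \<inter> ball y r) = {}"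
      using mixing_separated_balls_stiefel[OF act mix \<open>x \<in> ?St\<close> \<open>y \<in> ?St\<close> subset_refl] by blast
    then show ?thesis
      using op that by (intro exI[of _ "?St \<inter> ball x r"] exI[of _ "?St \<inter> ball y r"]) auto
  qed
  ultimately show ?thesis
    unfolding properly_discontinuous_action_def ts
    using group_action_induced_stiefel_action[OF act] induced_stiefel_action_diffeo[OF act] by blast
qed


subsection \<open>Proper discontinuity on the Grassmann manifold\<close>

lemma linear_isometry_orthogonal_matrix:
  assumes "orthogonal_matrix A"
  shows "linear_isometry ((*v) (transpose A :: real^'p^'p))"
proof -
  have "orthogonal_transformation ((*v) (transpose A))"
    using assms by (simp only: orthogonal_transformation_matrix matrix_of_matrix_vector_mul
        orthogonal_matrix_transpose matrix_vector_mul_linear simp_thms)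
  then show ?thesis
    unfolding orthogonal_transformation linear_isometry_def .
qed

lemma gr_class_iff:
  fixes x :: "(real, 'p::finite) vec \<Rightarrow>\<^sub>L 'h::real_inner"
  shows "y \<in> gr_class x \<longleftrightarrow> (\<exists>A. orthogonal_matrix A \<and> y = x o\<^sub>L Blinfun ((*v) (transpose A)))"
proof -
  have "blinfun_apply x \<circ> (\<lambda>v. transpose A *v v) = blinfun_apply (x o\<^sub>L Blinfun ((*v) (transpose A)))"
    for A :: "real^'p^'p"
    by (simp only: blinfun_compose.rep_eq bounded_linear_Blinfun_apply[OF matrix_vector_mul_bounded_linear])
  then show ?thesis
    by (simp only: gr_class_def mem_Collect_eq blinfun_apply_inject)
qed

text \<open>Preimages under an injective \<open>x\<close> are unique, hence depend linearly on the
  vector. The factor \<open>f\<close> is the change of frame, and it allows ranges to be compared by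
  dimension.\<close>

lemma range_subset_factorization:
  fixes x :: "'b::real_normed_vector \<Rightarrow>\<^sub>L 'c::real_normed_vector" and y :: "'a::real_normed_vector \<Rightarrow>\<^sub>L 'c"
  assumes inj: "inj (blinfun_apply x)" and sub: "range (blinfun_apply y) \<subseteq> range (blinfun_apply x)"
  obtains f where "linear f" and "\<And>v. blinfun_apply y v = blinfun_apply x (f v)"
proof -
  have "\<forall>v. \<exists>u. blinfun_apply y v = blinfun_apply x u"
    using sub by blast
  then obtain f where f: "\<And>v. blinfun_apply y v = blinfun_apply x (f v)"
    by metis
  have "linear f"
  proof (rule linearI)
    fix u v and c :: real
    have "blinfun_apply x (f (u + v)) = blinfun_apply x (f u + f v)"
      unfolding blinfun.add_right f[symmetric] ..
    then show "f (u + v) = f u + f v"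
      using inj by (simp add: inj_eq)
    have "blinfun_apply x (f (c *\<^sub>R v)) = blinfun_apply x (c *\<^sub>R f v)"
      unfolding blinfun.scaleR_right f[symmetric] ..
    then show "f (c *\<^sub>R v) = c *\<^sub>R f v"
      using inj by (simp add: inj_eq)
  qed
  then show thesis
    using f by (rule that)
qed

lemma stiefel_inj: "x \<in> stiefel \<Longrightarrow> inj (blinfun_apply x)"
  by (simp add: stiefel_iff_linear_isometry linear_isometry_inj)

text \<open>Two frames with the same range differ by a norm-preserving linear self-map of
  \<open>real^'p\<close>, that is, by an orthogonal matrix. So a class can be handled as a
  subspace.\<close>

lemma gr_class_eq:
  fixes x :: "(real, 'p::finite) vec \<Rightarrow>\<^sub>L 'h::real_inner"
  assumes x: "x \<in> stiefel"
  shows "gr_class x = {y \<in> stiefel. range (blinfun_apply y) = range (blinfun_apply x)}"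
proof (rule Set.set_eqI, rule iffI)
  fix y :: "(real, 'p) vec \<Rightarrow>\<^sub>L 'h" assume "y \<in> gr_class x"
  then obtain A where A: "orthogonal_matrix A"
    and y: "blinfun_apply y = blinfun_apply x \<circ> ((*v) (transpose A))"
    unfolding gr_class_def by blast
  have iso: "linear_isometry ((*v) (transpose A))"
    using A by (rule linear_isometry_orthogonal_matrix)
  then have "surj ((*v) (transpose A))"
    by (intro linear_inj_imp_surj linear_isometry_linear linear_isometry_inj)
  then have "range (blinfun_apply y) = range (blinfun_apply x)"
    unfolding y image_comp[symmetric] by (rule arg_cong)
  moreover have "y \<in> stiefel"
    using x iso by (simp only: stiefel_iff_linear_isometry y linear_isometry_compose)
  ultimately show "y \<in> {y \<in> stiefel. range (blinfun_apply y) = range (blinfun_apply x)}"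
    by simp
next
  fix y :: "(real, 'p) vec \<Rightarrow>\<^sub>L 'h"
  assume "y \<in> {y \<in> stiefel. range (blinfun_apply y) = range (blinfun_apply x)}"
  then have y: "y \<in> stiefel" and r: "range (blinfun_apply y) \<subseteq> range (blinfun_apply x)"
    by auto
  obtain f where f: "linear f" "\<And>v. blinfun_apply y v = blinfun_apply x (f v)"
    using range_subset_factorization[OF stiefel_inj[OF x] r] by blast
  have "norm (f v) = norm v" for v
    using f(2)[of v] x y by (metis stiefel_norm)
  then have "orthogonal_transformation f"
    using f(1) by (simp add: orthogonal_transformation)
  \<comment> \<open>The action in \<open>gr_class\<close> is through the transpose, hence the
    transposed witness.\<close>
  then have "orthogonal_matrix (transpose (matrix f))"
    by (simp add: orthogonal_transformation_matrix)
  moreover have "blinfun_apply y = blinfun_apply x \<circ> (\<lambda>v. transpose (transpose (matrix f)) *v v)"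
    using f by (auto simp: fun_eq_iff matrix_works)
  ultimately show "y \<in> gr_class x"
    unfolding gr_class_def by blast
qed

lemma gr_class_self: "x \<in> stiefel \<Longrightarrow> x \<in> gr_class x"
  by (simp add: gr_class_eq)

lemma gr_class_eq_iff:
  assumes x: "x \<in> stiefel" and y: "y \<in> stiefel"
  shows "gr_class x = gr_class y \<longleftrightarrow> range (blinfun_apply x) = range (blinfun_apply y)"
proof
  assume "gr_class x = gr_class y"
  then have "x \<in> gr_class y"
    using gr_class_self[OF x] by simp
  then show "range (blinfun_apply x) = range (blinfun_apply y)"
    by (simp add: gr_class_eq[OF y])
qed (simp add: gr_class_eq x y)

lemma gr_model_iff: "a \<in> gr_model x \<longleftrightarrow> (\<forall>v w. blinfun_apply x v \<bullet> blinfun_apply a w = 0)"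
proof -
  have "a \<in> gr_model x \<longleftrightarrow> (\<forall>w. adjoint (blinfun_apply x) (blinfun_apply a w) = 0)"
    by (simp add: gr_model_def fun_eq_iff)
  also have "\<dots> \<longleftrightarrow> (\<forall>v w. v \<bullet> adjoint (blinfun_apply x) (blinfun_apply a w) = 0)"
    by (metis inner_eq_zero_iff inner_zero_right)
  finally show ?thesis
    by (simp add: inner_blinfun_adjoint)
qed

text \<open>The range of \<open>a\<close> is orthogonal to that of \<open>x\<close>, so pairing
  \<open>(x + a) v\<close> with \<open>x v\<close> recovers \<open>v \<bullet> v\<close>. Hence
  \<open>x + a\<close> is injective and its range has orthonormal frames.\<close>

lemma gr_param_eq_gr_class:
  fixes x :: "(real, 'p::finite) vec \<Rightarrow>\<^sub>L 'h::real_inner"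
  assumes x: "x \<in> stiefel" and a: "a \<in> gr_model x"
  obtains y where "y \<in> stiefel" and "range (blinfun_apply y) = range (blinfun_apply (x + a))"
    and "gr_param x a = gr_class y"
proof -
  have lin: "linear (blinfun_apply (x + a))"
    by (rule bounded_linear.linear[OF blinfun.bounded_linear_right])
  have "v = 0" if "blinfun_apply (x + a) v = 0" for v
  proof -
    have "blinfun_apply x v \<bullet> blinfun_apply (x + a) v = v \<bullet> v"
      using x a by (simp add: blinfun.add_left inner_add_right stiefel_inner gr_model_iff)
    then show ?thesis
      using that by simp
  qed
  then have "inj (blinfun_apply (x + a))"
    using lin by (simp add: linear_injective_0)
  with lin obtain y :: "(real, 'p) vec \<Rightarrow>\<^sub>L 'h"
    where y: "y \<in> stiefel" "range (blinfun_apply y) = range (blinfun_apply (x + a))"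
    by (rule injective_range_in_stiefel)
  then show thesis
    using that[of y] by (simp add: gr_param_def gr_class_eq)
qed

definition gr_action ::
    "('a \<Rightarrow> 'h::real_inner \<Rightarrow> 'h) \<Rightarrow> 'a \<Rightarrow>
      ((real, 'p::finite) vec \<Rightarrow>\<^sub>L 'h) set \<Rightarrow> ((real, 'p) vec \<Rightarrow>\<^sub>L 'h) set"
  where "gr_action \<rho> g = (\<lambda>V\<in>grassmann. frame_action \<rho> g ` V)"

text \<open>Composition from the left commutes with the action of the orthogonal group from the
  right.\<close>

lemma frame_action_image_gr_class:
  fixes x :: "(real, 'b::finite) vec \<Rightarrow>\<^sub>L 'c::real_inner"
  shows "frame_action \<rho> g ` gr_class x = gr_class (frame_action \<rho> g x)"
proof -
  have eq: "frame_action \<rho> g (x o\<^sub>L B) = frame_action \<rho> g x o\<^sub>L B" for B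
    by (rule blinfun_eqI) (simp add: frame_action_def)
  have "gr_class y = (\<lambda>A. y o\<^sub>L Blinfun ((*v) (transpose A))) ` Collect orthogonal_matrix"
    for y :: "(real, 'b) vec \<Rightarrow>\<^sub>L 'c"
    by (auto simp: gr_class_iff)
  then show ?thesis
    by (simp add: image_image eq)
qed

lemma gr_action_gr_class:
  "x \<in> stiefel \<Longrightarrow> gr_action \<rho> g (gr_class x) = gr_class (frame_action \<rho> g x)"
  by (simp add: gr_action_def grassmann_def frame_action_image_gr_class)

text \<open>The image of a ball of frames under the quotient map: a single nearby frame suffices.
  These sets replace metric balls in the quotient topology.\<close>

definition gr_ball :: "((real, 'p::finite) vec \<Rightarrow>\<^sub>L 'h::real_inner) \<Rightarrow> real \<Rightarrow> ((real, 'p) vec \<Rightarrow>\<^sub>L 'h) set set"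
  where "gr_ball x r = {V \<in> grassmann. V \<inter> ball x r \<noteq> {}}"

text \<open>If the frame \<open>w o\<^sub>L B\<close> lies in the ball, with \<open>B\<close>
  orthogonal, then moving \<open>w\<close> moves \<open>w o\<^sub>L B\<close> by no more, so nearby
  \<open>w\<close> stay in the preimage.\<close>

lemma openin_gr_ball: "openin grassmann_topology (gr_ball x r)"
proof -
  have "\<exists>e>0. \<forall>w'\<in>stiefel. dist w' w < e \<longrightarrow> gr_class w' \<in> gr_ball x r"
    if "gr_class w \<in> gr_ball x r" for w
  proof -
    obtain z where z: "z \<in> gr_class w" "dist x z < r"
      using \<open>gr_class w \<in> gr_ball x r\<close> by (auto simp: gr_ball_def)
    then obtain A where A: "orthogonal_matrix A" "z = w o\<^sub>L Blinfun ((*v) (transpose A))"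
      by (auto simp: gr_class_iff)
    let ?B = "Blinfun ((*v) (transpose A))"
    have "gr_class w' \<in> gr_ball x r" if w': "w' \<in> stiefel" "dist w' w < r - dist x z" for w'
    proof -
      have "(w' - w) o\<^sub>L ?B = (w' o\<^sub>L ?B) - z"
        by (rule blinfun_eqI) (simp add: A blinfun.diff_left)
      then have "dist (w' o\<^sub>L ?B) z \<le> dist w' w"
        using norm_compose_linear_isometry[OF linear_isometry_orthogonal_matrix[OF A(1)], of "w' - w"]
        by (simp add: dist_norm)
      then have "dist x (w' o\<^sub>L ?B) < r"
        using w'(2) dist_triangle[of x "w' o\<^sub>L ?B" z] by (simp add: dist_commute)
      moreover have "w' o\<^sub>L ?B \<in> gr_class w'"
        using A(1) by (auto simp: gr_class_iff)
      ultimately show ?thesis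
        using w'(1) by (auto simp: gr_ball_def grassmann_def)
    qed
    then show ?thesis
      using z(2) by (intro exI[of _ "r - dist x z"]) auto
  qed
  then show ?thesis
    unfolding openin_grassmann_topology stiefel_topology_def
    by (auto simp: openin_euclidean_subtopology_iff gr_ball_def)
qed

lemma gr_class_in_gr_ball: "x \<in> stiefel \<Longrightarrow> r > 0 \<Longrightarrow> gr_class x \<in> gr_ball x r"
  using gr_class_self[of x] by (auto simp: gr_ball_def grassmann_def)

text \<open>By equality of dimensions some \<open>y v\<close> lies outside the range of
  \<open>x\<close>. That range is closed, being an isometric image of a complete space, so
  \<open>y v\<close> has positive distance from it; dividing by the norm of \<open>v\<close> bounds
  the operator norm for all frames of the class.\<close>

lemma distinct_ranges_separated:
  fixes x y :: "(real, 'p::finite) vec \<Rightarrow>\<^sub>L 'h::real_inner"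
  assumes x: "x \<in> stiefel" and y: "y \<in> stiefel"
    and ne: "range (blinfun_apply x) \<noteq> range (blinfun_apply y)"
  shows "\<exists>d>0. \<forall>z\<in>gr_class x. d \<le> norm (z - y)"
proof -
  have "closed (range (blinfun_apply x))"
    using x
    by (intro complete_imp_closed complete_isometric_image[where e=1] blinfun.bounded_linear_right)
      (auto simp: stiefel_norm)
  have "\<not> range (blinfun_apply y) \<subseteq> range (blinfun_apply x)"
  proof
    assume sub: "range (blinfun_apply y) \<subseteq> range (blinfun_apply x)"
    obtain f where "linear f" and f: "\<And>v. blinfun_apply y v = blinfun_apply x (f v)"
      using range_subset_factorization[OF stiefel_inj[OF x] sub] by blast
    have "inj f"
      using f stiefel_inj[OF y] by (metis injD injI)
    with \<open>linear f\<close> have "surj f"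
      by (intro linear_inj_imp_surj)
    then have "range (blinfun_apply x) \<subseteq> range (blinfun_apply y)"
      using f by (metis image_subsetI rangeI surjD)
    then show False
      using sub ne by blast
  qed
  then obtain v where v: "blinfun_apply y v \<notin> range (blinfun_apply x)"
    by blast
  then have "v \<noteq> 0"
    by (metis blinfun.zero_right rangeI)
  obtain e where "e > 0" and e: "ball (blinfun_apply y v) e \<inter> range (blinfun_apply x) = {}"
    using \<open>closed _\<close> v by (metis Compl_iff closed_def open_contains_ball disjoint_eq_subset_Compl)
  have "e / norm v \<le> norm (z - y)" if "z \<in> gr_class x" for z
  proof -
    have "blinfun_apply z v \<in> range (blinfun_apply x)"
      using that x by (auto simp: gr_class_eq)
    then have "e \<le> dist (blinfun_apply y v) (blinfun_apply z v)"
      using e by (metis IntI empty_iff linorder_not_le mem_ball)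
    also have "\<dots> = norm (blinfun_apply (z - y) v)"
      by (simp add: dist_norm blinfun.diff_left norm_minus_commute)
    also have "\<dots> \<le> norm (z - y) * norm v"
      by (rule norm_blinfun)
    finally show ?thesis
      using \<open>v \<noteq> 0\<close> by (simp add: pos_divide_le_eq)
  qed
  then show ?thesis
    using \<open>e > 0\<close> \<open>v \<noteq> 0\<close> by (intro exI[of _ "e / norm v"]) auto
qed

context
  fixes \<Gamma> :: "('a, 'b) monoid_scheme" and \<rho> :: "'a \<Rightarrow> 'h::real_inner \<Rightarrow> 'h"
  assumes action: "linear_isometric_action \<Gamma> \<rho>"
begin

lemma group_action_gr_action:
  "group_action \<Gamma> (grassmann :: ((real, 'p::finite) vec \<Rightarrow>\<^sub>L 'h) set set) (gr_action \<rho>)"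
proof (rule group_actionI)
  show "group \<Gamma>"
    by (rule linear_isometric_actionD[OF action])
  show "gr_action \<rho> g \<in> extensional grassmann" for g
    by (simp add: gr_action_def)
qed (use linear_isometric_actionD(1)[OF action] in \<open>auto simp: grassmann_def gr_action_gr_class
    frame_action_stiefel[OF action] frame_action_one[OF action] frame_action_mult[OF action]
    group.is_monoid monoid.m_closed monoid.one_closed\<close>)

lemma range_frame_action:
  "g \<in> carrier \<Gamma> \<Longrightarrow> range (blinfun_apply (frame_action \<rho> g x)) = \<rho> g ` range (blinfun_apply x)"
  by (auto simp: frame_action_apply[OF action])

text \<open>An isometry carries the chart at \<open>x\<close> to the chart at the image frame, and
  in these two charts it is the bounded linear map \<open>frame_action\<close>. This is what makes
  the action smooth.\<close>

lemma gr_action_gr_param: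
  assumes g: "g \<in> carrier \<Gamma>" and x: "x \<in> stiefel" and a: "a \<in> gr_model x"
  shows "gr_param x a \<in> grassmann"
    and "frame_action \<rho> g a \<in> gr_model (frame_action \<rho> g x)"
    and "gr_action \<rho> g (gr_param x a) = gr_param (frame_action \<rho> g x) (frame_action \<rho> g a)"
proof -
  obtain y where y: "y \<in> stiefel" "range (blinfun_apply y) = range (blinfun_apply (x + a))"
    "gr_param x a = gr_class y"
    using gr_param_eq_gr_class[OF x a] .
  then show "gr_param x a \<in> grassmann"
    by (simp add: grassmann_def)
  show "frame_action \<rho> g a \<in> gr_model (frame_action \<rho> g x)"
    using a by (simp add: gr_model_iff frame_action_apply[OF action g]
        linear_isometry_inner[OF linear_isometric_actionD(2)[OF action g]])
  have "range (blinfun_apply (frame_action \<rho> g y)) = range (blinfun_apply (frame_action \<rho> g (x + a)))"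
    by (simp only: range_frame_action[OF g] y(2))
  also have "frame_action \<rho> g (x + a) = frame_action \<rho> g x + frame_action \<rho> g a"
    by (rule linear_add[OF bounded_linear.linear[OF bounded_linear_frame_action[OF action]]])
  finally have "gr_class (frame_action \<rho> g y) = gr_param (frame_action \<rho> g x) (frame_action \<rho> g a)"
    using y(1) g by (simp add: gr_param_def gr_class_eq frame_action_stiefel[OF action])
  then show "gr_action \<rho> g (gr_param x a) = gr_param (frame_action \<rho> g x) (frame_action \<rho> g a)"
    using y by (simp add: gr_action_gr_class)
qed

text \<open>Stated for any \<open>F\<close> that agrees with the action on \<open>grassmann\<close>,
  so that it also covers \<open>inv_into\<close>, whose values elsewhere are unspecified.\<close>

lemma grassmann_smooth_gr_action:
  assumes g: "g \<in> carrier \<Gamma>"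
    and F: "\<And>V. V \<in> grassmann \<Longrightarrow> F V = gr_action \<rho> g V"
  shows "grassmann_smooth (F :: ((real, 'p::finite) vec \<Rightarrow>\<^sub>L 'h) set \<Rightarrow> _)"
  unfolding grassmann_smooth_def
proof
  fix V :: "((real, 'p) vec \<Rightarrow>\<^sub>L 'h) set" assume "V \<in> grassmann"
  then obtain x where x: "x \<in> stiefel" "V = gr_class x"
    by (auto simp: grassmann_def)
  \<comment> \<open>The subspace is the centre of the chart at any of its frames, so the whole model
    space can be taken as \<open>D\<close>.\<close>
  have "V = gr_param x 0"
    using x by (simp add: gr_param_def gr_class_eq)
  moreover have "0 \<in> gr_model x"
    by (simp add: gr_model_iff)
  ultimately have V: "V \<in> gr_param x ` gr_model x"
    by blast
  show "\<exists>x\<in>stiefel. \<exists>y\<in>stiefel. \<exists>D f.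
        openin (top_of_set (gr_model x)) D \<and> V \<in> gr_param x ` D \<and>
        f ` D \<subseteq> gr_model y \<and> smooth_on_subset D f \<and>
        (\<forall>a\<in>D. F (gr_param x a) = gr_param y (f a))"
    using x(1) V F frame_action_stiefel[OF action g x(1)] gr_action_gr_param[OF g x(1)]
      smooth_on_subset_bounded_linear[OF bounded_linear_frame_action[OF action] refl]
    by (intro bexI[of _ x] bexI[of _ "frame_action \<rho> g x"] exI[of _ "gr_model x"]
        exI[of _ "frame_action \<rho> g"] conjI) auto
qed

lemma gr_action_diffeo:
  assumes g: "g \<in> carrier \<Gamma>"
  shows "(gr_action \<rho> g :: ((real, 'p::finite) vec \<Rightarrow>\<^sub>L 'h) set \<Rightarrow> _) \<in> grassmann_diffeos"
proof -
  interpret group_action \<Gamma> "grassmann :: ((real, 'p) vec \<Rightarrow>\<^sub>L 'h) set set" "gr_action \<rho>"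
    by (rule group_action_gr_action)
  have "inv\<^bsub>\<Gamma>\<^esub> g \<in> carrier \<Gamma>"
    using g linear_isometric_actionD(1)[OF action] by simp
  then show ?thesis
    unfolding grassmann_diffeos_def
    using bij_prop0[OF g] g
    by (auto simp: Bij_def inv_into_eq intro: grassmann_smooth_gr_action)
qed

text \<open>The frame of \<open>V\<close> close to \<open>x\<close> and the frame of
  \<open>V\<close> that \<open>g\<close> brings close to \<open>y\<close> may differ by an
  orthogonal matrix. The same matrix applied to \<open>x\<close> gives another frame of its class,
  which is why the bound must be uniform over \<open>gr_class x\<close>.\<close>

lemma mixing_separated_gr_balls:
  fixes x y :: "(real, 'p::finite) vec \<Rightarrow>\<^sub>L 'h"
  assumes mix: "mixing \<Gamma> \<rho>" and x: "x \<in> stiefel" and y: "y \<in> stiefel" and S: "S \<subseteq> carrier \<Gamma>"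
    and ne: "\<And>g. g \<in> S \<Longrightarrow> range (blinfun_apply (frame_action \<rho> g x)) \<noteq> range (blinfun_apply y)"
  shows "\<exists>r>0. \<forall>g\<in>S. gr_action \<rho> g ` gr_ball x r \<inter> gr_ball y r = {}"
proof -
  have "\<exists>d>0. \<forall>z\<in>gr_class x. d \<le> norm (frame_action \<rho> g z - y)" if "g \<in> S" for g
  proof -
    have "frame_action \<rho> g x \<in> stiefel"
      using that S x by (intro frame_action_stiefel[OF action]) auto
    from distinct_ranges_separated[OF this y ne[OF that]]
    show ?thesis
      by (auto simp flip: frame_action_image_gr_class)
  qed
  then have "\<exists>d>0. \<forall>g\<in>S. \<forall>z\<in>gr_class x. d \<le> norm (frame_action \<rho> g z - y)"
    using x by (intro mixing_separation[OF action mix x y _ _ S]) (auto simp: gr_class_eq)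
  then obtain d where d: "d > 0" "\<And>g z. g \<in> S \<Longrightarrow> z \<in> gr_class x \<Longrightarrow> d \<le> norm (frame_action \<rho> g z - y)"
    by blast
  have False if "g \<in> S" "V \<in> gr_ball x (d / 2)" "gr_action \<rho> g V \<in> gr_ball y (d / 2)" for g V
  proof -
    have g: "g \<in> carrier \<Gamma>"
      using that S by blast
    obtain z where V: "V \<in> grassmann" and z: "z \<in> V" "dist x z < d / 2"
      using \<open>V \<in> gr_ball x (d / 2)\<close> by (auto simp: gr_ball_def)
    obtain z' where "z' \<in> gr_action \<rho> g V" "dist y z' < d / 2"
      using \<open>gr_action \<rho> g V \<in> gr_ball y (d / 2)\<close> by (auto simp: gr_ball_def)
    then obtain u where u: "u \<in> V" "dist y (frame_action \<rho> g u) < d / 2"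
      using V by (auto simp: gr_action_def)
    have "z \<in> stiefel" "u \<in> stiefel" "u \<in> gr_class z"
      using V z(1) u(1) by (auto simp: grassmann_def gr_class_eq)
    then obtain A where A: "orthogonal_matrix A" "u = z o\<^sub>L Blinfun ((*v) (transpose A))"
      by (auto simp: gr_class_iff)
    let ?B = "Blinfun ((*v) (transpose A))"
    have xB: "x o\<^sub>L ?B \<in> gr_class x"
      using A(1) by (auto simp: gr_class_iff)
    have "(x - z) o\<^sub>L ?B = (x o\<^sub>L ?B) - u"
      by (rule blinfun_eqI) (simp add: A blinfun.diff_left)
    then have 1: "norm ((x o\<^sub>L ?B) - u) \<le> dist x z"
      using norm_compose_linear_isometry[OF linear_isometry_orthogonal_matrix[OF A(1)], of "x - z"]
      by (simp add: dist_norm)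
    have "d \<le> norm (frame_action \<rho> g (x o\<^sub>L ?B) - y)"
      using d(2) \<open>g \<in> S\<close> xB by blast
    also have "\<dots> \<le> norm (frame_action \<rho> g (x o\<^sub>L ?B) - frame_action \<rho> g u) + norm (frame_action \<rho> g u - y)"
      by norm
    also have "\<dots> \<le> dist x z + dist y (frame_action \<rho> g u)"
      using norm_frame_action_diff[OF action g, of "x o\<^sub>L ?B" u] 1
      by (simp add: dist_norm norm_minus_commute)
    also have "\<dots> < d"
      using z(2) u(2) by simp
    finally show False
      by simp
  qed
  then show ?thesis
    using d(1) by (intro exI[of _ "d / 2"]) auto
qed

text \<open>Infinite order enters through condition (1): a nontrivial element must not map a
  subspace to itself, even with a different frame.\<close>

theorem mixing_properly_discontinuous_grassmann:
  assumes mix: "mixing \<Gamma> \<rho>"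
    and tf: "\<And>g (n::nat). g \<in> carrier \<Gamma> \<Longrightarrow> g \<noteq> \<one>\<^bsub>\<Gamma>\<^esub> \<Longrightarrow> n > 0 \<Longrightarrow> g [^]\<^bsub>\<Gamma>\<^esub> n \<noteq> \<one>\<^bsub>\<Gamma>\<^esub>"
  shows "properly_discontinuous_action \<Gamma>
    (grassmann_topology :: ((real, 'p::finite) vec \<Rightarrow>\<^sub>L 'h) set topology)
    grassmann_diffeos (gr_action \<rho>)"
proof -
  let ?Gr = "grassmann :: ((real, 'p) vec \<Rightarrow>\<^sub>L 'h) set set"
  have "\<exists>U. openin grassmann_topology U \<and> V \<in> U \<and>
        (\<forall>g\<in>carrier \<Gamma>. g \<noteq> \<one>\<^bsub>\<Gamma>\<^esub> \<longrightarrow> gr_action \<rho> g ` U \<inter> U = {})" if V: "V \<in> ?Gr" for V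
  proof -
    obtain x where x: "x \<in> stiefel" "V = gr_class x"
      using V by (auto simp: grassmann_def)
    obtain r where "r > 0" "\<forall>g\<in>carrier \<Gamma> - {\<one>\<^bsub>\<Gamma>\<^esub>}. gr_action \<rho> g ` gr_ball x r \<inter> gr_ball x r = {}"
      using mixing_separated_gr_balls[OF mix x(1) x(1), of "carrier \<Gamma> - {\<one>\<^bsub>\<Gamma>\<^esub>}"]
        mixing_no_invariant_frame[OF action mix _ tf x(1)] by auto
    then show ?thesis
      using x openin_gr_ball gr_class_in_gr_ball by (intro exI[of _ "gr_ball x r"]) auto
  qed
  moreover have "\<exists>U U'. openin grassmann_topology U \<and> V \<in> U \<and> openin grassmann_topology U' \<and> W \<in> U' \<and>
        (\<forall>g\<in>carrier \<Gamma>. gr_action \<rho> g ` U \<inter> U' = {})"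
    if V: "V \<in> ?Gr" and W: "W \<in> ?Gr" and nW: "W \<notin> orbit \<Gamma> (gr_action \<rho>) V" for V W
  proof -
    obtain x y where x: "x \<in> stiefel" "V = gr_class x" and y: "y \<in> stiefel" "W = gr_class y"
      using V W by (auto simp: grassmann_def)
    have "range (blinfun_apply (frame_action \<rho> g x)) \<noteq> range (blinfun_apply y)" if "g \<in> carrier \<Gamma>" for g
    proof -
      have "W \<noteq> gr_action \<rho> g V"
        using nW that by (auto simp: orbit_def)
      then show ?thesis
        using x y that by (auto simp: gr_action_gr_class gr_class_eq_iff frame_action_stiefel[OF action])
    qed
    then obtain r where "r > 0" "\<forall>g\<in>carrier \<Gamma>. gr_action \<rho> g ` gr_ball x r \<inter> gr_ball y r = {}"
      using mixing_separated_gr_balls[OF mix x(1) y(1) subset_refl] by blast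
    then show ?thesis
      using x y openin_gr_ball gr_class_in_gr_ball
      by (intro exI[of _ "gr_ball x r"] exI[of _ "gr_ball y r"]) auto
  qed
  ultimately show ?thesis
    unfolding properly_discontinuous_action_def topspace_grassmann_topology
    using group_action_gr_action gr_action_diffeo by blast
qed

end


subsection \<open>Regular representations\<close>

lemma orthonormal_family_extends_indexed:
  fixes e :: "'i \<Rightarrow> 'h::real_inner" and f :: "'i \<Rightarrow> 'k::{real_inner, complete_space}"
  assumes B: "hilbert_basis B" and e: "bij_betw e I B"
    and f: "\<And>i j. i \<in> I \<Longrightarrow> j \<in> I \<Longrightarrow> f i \<bullet> f j = (if i = j then 1 else 0)"
  shows "\<exists>T. linear_isometry T \<and> (\<forall>i\<in>I. T (e i) = f i)"
proof -
  have "\<exists>T. linear_isometry T \<and> (\<forall>b\<in>B. T b = f (inv_into I e b))"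
  proof (rule orthonormal_family_extends[OF B])
    fix b c assume "b \<in> B" "c \<in> B"
    then show "f (inv_into I e b) \<bullet> f (inv_into I e c) = (if b = c then 1 else 0)"
      using e f[of "inv_into I e b" "inv_into I e c"]
      by (metis bij_betw_imp_surj_on f_inv_into_f inv_into_into)
  qed
  then show ?thesis
    using e by (metis bij_betwE bij_betw_inv_into_left)
qed

text \<open>The vectors \<open>v\<close> for which \<open>T g v\<close> vanishes at infinity form a
  subspace, and the uniform bound \<open>K\<close> makes it closed: an approximation of
  \<open>v\<close> within \<open>\<epsilon> / (2 * K)\<close> changes \<open>T g v\<close> by less
  than \<open>\<epsilon> / 2\<close>.\<close>

lemma vanishing_on_hilbert_basis:
  fixes T :: "'i \<Rightarrow> 'h::real_inner \<Rightarrow> real"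
  assumes B: "hilbert_basis B" and lin: "\<And>g. g \<in> A \<Longrightarrow> linear (T g)"
    and bnd: "\<And>g v. g \<in> A \<Longrightarrow> \<bar>T g v\<bar> \<le> K * norm v" and "K > 0"
    and van: "\<And>b \<epsilon>. b \<in> B \<Longrightarrow> \<epsilon> > 0 \<Longrightarrow> finite {g \<in> A. \<epsilon> \<le> \<bar>T g b\<bar>}"
    and "\<epsilon> > 0"
  shows "finite {g \<in> A. \<epsilon> \<le> \<bar>T g v\<bar>}"
proof -
  define S where "S = {v. \<forall>\<epsilon>>0. finite {g \<in> A. \<epsilon> \<le> \<bar>T g v\<bar>}}"
  have "S = UNIV"
  proof (rule closed_subspace_hilbert_basis_UNIV[OF B])
    show "subspace S"
    proof (rule subspaceI)
      have "finite {g \<in> A. \<epsilon> \<le> \<bar>T g 0\<bar>}" if "\<epsilon> > 0" for \<epsilon>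
        by (rule finite_subset[of _ "{}"]) (use that lin in \<open>auto simp: linear_0\<close>)
      then show "0 \<in> S"
        by (simp add: S_def)
    next
      fix v w assume vw: "v \<in> S" "w \<in> S"
      have "finite {g \<in> A. \<epsilon> \<le> \<bar>T g (v + w)\<bar>}" if "\<epsilon> > 0" for \<epsilon>
      proof (rule finite_subset)
        show "{g \<in> A. \<epsilon> \<le> \<bar>T g (v + w)\<bar>} \<subseteq> {g \<in> A. \<epsilon> / 2 \<le> \<bar>T g v\<bar>} \<union> {g \<in> A. \<epsilon> / 2 \<le> \<bar>T g w\<bar>}"
          using lin by (auto simp: linear_add)
        show "finite ({g \<in> A. \<epsilon> / 2 \<le> \<bar>T g v\<bar>} \<union> {g \<in> A. \<epsilon> / 2 \<le> \<bar>T g w\<bar>})"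
          using vw half_gt_zero[OF that] unfolding S_def by blast
      qed
      then show "v + w \<in> S"
        by (simp add: S_def)
    next
      fix c v assume v: "v \<in> S"
      have "finite {g \<in> A. \<epsilon> \<le> \<bar>T g (c *\<^sub>R v)\<bar>}" if "\<epsilon> > 0" for \<epsilon>
      proof (rule finite_subset)
        \<comment> \<open>The summand 1 avoids a separate case for \<open>c = 0\<close>.\<close>
        show "{g \<in> A. \<epsilon> \<le> \<bar>T g (c *\<^sub>R v)\<bar>} \<subseteq> {g \<in> A. \<epsilon> / (\<bar>c\<bar> + 1) \<le> \<bar>T g v\<bar>}"
        proof clarify
          fix g assume "g \<in> A" "\<epsilon> \<le> \<bar>T g (c *\<^sub>R v)\<bar>"
          then have "\<epsilon> \<le> \<bar>c\<bar> * \<bar>T g v\<bar>"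
            using lin by (simp add: linear_scale abs_mult)
          also have "\<dots> \<le> (\<bar>c\<bar> + 1) * \<bar>T g v\<bar>"
            by (intro mult_right_mono) auto
          finally show "\<epsilon> / (\<bar>c\<bar> + 1) \<le> \<bar>T g v\<bar>"
            by (simp add: pos_divide_le_eq mult.commute)
        qed
        show "finite {g \<in> A. \<epsilon> / (\<bar>c\<bar> + 1) \<le> \<bar>T g v\<bar>}"
          using v that by (simp add: S_def)
      qed
      then show "c *\<^sub>R v \<in> S"
        by (simp add: S_def)
    qed
    have "v \<in> S" if v: "v \<in> closure S" for v
    proof -
      have "finite {g \<in> A. \<epsilon> \<le> \<bar>T g v\<bar>}" if "\<epsilon> > 0" for \<epsilon>
      proof -
        have "\<epsilon> / (2 * K) > 0"
          using \<open>\<epsilon> > 0\<close> \<open>K > 0\<close> by simp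
        then obtain w where w: "w \<in> S" "dist w v < \<epsilon> / (2 * K)"
          using v unfolding closure_approachable by blast
        have "{g \<in> A. \<epsilon> \<le> \<bar>T g v\<bar>} \<subseteq> {g \<in> A. \<epsilon> / 2 \<le> \<bar>T g w\<bar>}"
        proof clarify
          fix g assume g: "g \<in> A" "\<epsilon> \<le> \<bar>T g v\<bar>"
          have "\<bar>T g v - T g w\<bar> \<le> K * norm (v - w)"
            using bnd[OF g(1), of "v - w"] lin[OF g(1)] by (simp add: linear_diff)
          also have "\<dots> < \<epsilon> / 2"
            using w(2) \<open>K > 0\<close> by (simp add: dist_norm norm_minus_commute field_simps)
          finally show "\<epsilon> / 2 \<le> \<bar>T g w\<bar>"
            using g(2) by linarith
        qed
        moreover have "finite {g \<in> A. \<epsilon> / 2 \<le> \<bar>T g w\<bar>}"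
          using w(1) half_gt_zero[OF \<open>\<epsilon> > 0\<close>] unfolding S_def by blast
        ultimately show ?thesis
          by (rule finite_subset)
      qed
      then show ?thesis
        by (simp add: S_def)
    qed
    then show "closed S"
      by (metis closure_subset closure_closed closed_closure subset_antisym subsetI)
    show "B \<subseteq> S"
      using van by (auto simp: S_def)
  qed
  then show ?thesis
    using \<open>\<epsilon> > 0\<close> by (auto simp: S_def)
qed

text \<open>The vectors \<open>e (x, False)\<close> and \<open>e (x, True)\<close> stand for delta_x
  and i delta_x in complex l^2(G), \<open>U\<close> is left translation and \<open>J\<close> is
  multiplication by i. An isometry is determined by its values on the basis, so every identity is
  checked there.\<close>

lemma complex_regular_representation:
  fixes G :: "('g, 'c) monoid_scheme" (structure) and B :: "'h::{real_inner, complete_space} set"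
  assumes grp: "group G" and B: "hilbert_basis B" and e: "bij_betw e (carrier G \<times> (UNIV :: bool set)) B"
  obtains U :: "'g \<Rightarrow> 'h \<Rightarrow> 'h" and J where "linear_isometric_action G U" and "mixing G U" and "linear_isometry J"
    and "\<And>v. J (J v) = - v" and "\<And>g v. g \<in> carrier G \<Longrightarrow> U g (J v) = J (U g v)"
proof -
  interpret group G by fact
  let ?I = "carrier G \<times> (UNIV :: bool set)"
  have eB: "e i \<in> B" if "i \<in> ?I" for i
    using e that by (rule bij_betwE[THEN bspec])
  have ee: "e i \<bullet> e j = (if i = j then 1 else 0)" if "i \<in> ?I" "j \<in> ?I" for i j
    using hilbert_basis_inner[OF B eB eB] that e unfolding bij_betw_def inj_on_def by metis
  have ext: "S = T" if "linear_isometry S" "linear_isometry T" "\<And>x c. x \<in> carrier G \<Longrightarrow> S (e (x, c)) = T (e (x, c))"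
    for S T :: "'h \<Rightarrow> 'h"
  proof (rule bounded_linear_eq_on_hilbert_basis[OF B])
    fix b assume "b \<in> B"
    then obtain i where "i \<in> ?I" "b = e i"
      using e by (metis bij_betw_imp_surj_on imageE)
    then show "S b = T b"
      using that(3) by auto
  qed (use that in \<open>auto intro: linear_isometry_bounded_linear\<close>)
  have "\<exists>T. linear_isometry T \<and> (\<forall>i\<in>?I. T (e i) = e (g \<otimes> fst i, snd i))" if "g \<in> carrier G" for g
    by (rule orthonormal_family_extends_indexed[OF B e])
      (use that in \<open>auto simp: ee split: if_splits\<close>)
  then have "\<forall>g\<in>carrier G. \<exists>T. linear_isometry T \<and> (\<forall>i\<in>?I. T (e i) = e (g \<otimes> fst i, snd i))"
    by blast
  then obtain U where U: "\<And>g. g \<in> carrier G \<Longrightarrow> linear_isometry (U g)"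
    "\<And>g x c. g \<in> carrier G \<Longrightarrow> x \<in> carrier G \<Longrightarrow> U g (e (x, c)) = e (g \<otimes> x, c)"
    by (auto dest!: bchoice)
  have "\<exists>T. linear_isometry T \<and> (\<forall>i\<in>?I. T (e i) = (if snd i then - 1 else 1) *\<^sub>R e (fst i, \<not> snd i))"
    by (rule orthonormal_family_extends_indexed[OF B e])
      (auto simp: ee split: if_splits)
  then obtain J where J: "linear_isometry J"
    "\<And>x c. x \<in> carrier G \<Longrightarrow> J (e (x, c)) = (if c then - 1 else 1) *\<^sub>R e (x, \<not> c)"
    by auto
  note lin = linear_isometry_linear[OF U(1)] linear_isometry_linear[OF J(1)]
  show thesis
  proof (rule that[of U J])
    show "linear_isometric_action G U"
    proof (rule linear_isometric_actionI[OF grp U(1)])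
      have "U \<one> = (\<lambda>v. v)"
        by (rule ext) (auto simp: U linear_isometry_def[of "\<lambda>v. v"] linear_id[unfolded id_def])
      then show "U \<one> v = v" for v
        by simp
      show "U (g \<otimes> h) v = U g (U h v)" if "g \<in> carrier G" "h \<in> carrier G" for g h v
      proof -
        have "U (g \<otimes> h) = U g \<circ> U h"
          using that by (intro ext) (auto simp: U m_assoc intro: linear_isometry_compose)
        then show ?thesis
          by simp
      qed
    qed
    show "linear_isometry J"
      by (rule J)
    show "J (J v) = - v" for v
    proof -
      have "linear_isometry (\<lambda>v::'h. - v)"
        by (simp add: linear_isometry_def linear_uminus)
      then have "J \<circ> J = (\<lambda>v. - v)"
        using J by (intro ext) (auto intro: linear_isometry_compose simp: linear_neg[OF lin(2)])
      then show ?thesis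
        by (metis comp_apply)
    qed
    show "U g (J v) = J (U g v)" if "g \<in> carrier G" for g v
    proof -
      have "U g \<circ> J = J \<circ> U g"
        using that by (intro ext) (auto intro: linear_isometry_compose simp: U J linear_neg[OF lin(1)])
      then show ?thesis
        by (metis comp_apply)
    qed
    have cs: "\<bar>U g v \<bullet> w\<bar> \<le> norm v * norm w" if "g \<in> carrier G" for g v w
      using Cauchy_Schwarz_ineq2[of "U g v" w] by (simp add: linear_isometry_norm[OF U(1)[OF that]])
    have basis: "finite {g \<in> carrier G. \<epsilon> \<le> \<bar>U g b \<bullet> c\<bar>}" if "b \<in> B" "c \<in> B" "\<epsilon> > 0" for b c \<epsilon>
    proof -
      obtain x y s t where xy: "x \<in> carrier G" "y \<in> carrier G" "b = e (x, s)" "c = e (y, t)"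
        using e \<open>b \<in> B\<close> \<open>c \<in> B\<close> unfolding bij_betw_def by blast
      \<comment> \<open>Basis vectors are permuted, so a nonzero coefficient between two of them
        determines \<open>g\<close>.\<close>
      have "g = y \<otimes> inv x" if "g \<in> carrier G" "\<epsilon> \<le> \<bar>U g b \<bullet> c\<bar>" for g
        using that xy \<open>\<epsilon> > 0\<close> by (auto simp: U ee inv_solve_right split: if_splits)
      then have "{g \<in> carrier G. \<epsilon> \<le> \<bar>U g b \<bullet> c\<bar>} \<subseteq> {y \<otimes> inv x}"
        by blast
      then show ?thesis
        by (rule finite_subset) simp
    qed
    \<comment> \<open>The extension to all vectors takes two rounds, first in the left argument
      against a basis vector, then in the right one. The summand 1 in \<open>K\<close> keeps the
      bound positive.\<close>
    have left: "finite {g \<in> carrier G. \<epsilon> \<le> \<bar>U g v \<bullet> c\<bar>}" if "c \<in> B" "\<epsilon> > 0" for v c \<epsilon>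
    proof (rule vanishing_on_hilbert_basis[OF B, where T="\<lambda>g v. U g v \<bullet> c" and K="norm c + 1"])
      show "linear (\<lambda>v. U g v \<bullet> c)" if "g \<in> carrier G" for g
        using lin(1)[OF that] by (intro linearI) (simp_all add: linear_add linear_scale inner_add_left)
      show "\<bar>U g v \<bullet> c\<bar> \<le> (norm c + 1) * norm v" if "g \<in> carrier G" for g v
        unfolding distrib_right mult_1 mult.commute[of "norm c" "norm v"]
        using cs[OF that, of v c] norm_ge_zero[of v] by linarith
    qed (use that basis in \<open>auto simp: add_nonneg_pos\<close>)
    show "mixing G U"
      unfolding mixing_def
    proof (intro allI impI)
      fix v w :: 'h and \<epsilon> :: real assume "\<epsilon> > 0"
      show "finite {g \<in> carrier G. \<epsilon> \<le> \<bar>U g v \<bullet> w\<bar>}"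
      proof (rule vanishing_on_hilbert_basis[OF B, where T="\<lambda>g w. U g v \<bullet> w" and K="norm v + 1"])
        show "linear (\<lambda>w. U g v \<bullet> w)" for g
          by (intro linearI) (simp_all add: inner_add_right)
        show "\<bar>U g v \<bullet> w\<bar> \<le> (norm v + 1) * norm w" if "g \<in> carrier G" for g w
          unfolding distrib_right mult_1
          using cs[OF that, of v w] norm_ge_zero[of w] by linarith
      qed (use left \<open>\<epsilon> > 0\<close> in \<open>auto simp: add_nonneg_pos\<close>)
    qed
  qed
qed

context
  fixes G :: "('g, 'c) monoid_scheme" and \<Gamma> :: "('a, 'b) monoid_scheme"
    and U :: "'g \<Rightarrow> 'h::real_inner \<Rightarrow> 'h" and J :: "'h \<Rightarrow> 'h"
    and \<pi> :: "'a \<Rightarrow> 'g" and \<omega> :: "'a \<Rightarrow> complex"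
  assumes U: "linear_isometric_action G U" and J: "linear_isometry J"
    and JJ: "\<And>v. J (J v) = - v" and UJ: "\<And>g v. g \<in> carrier G \<Longrightarrow> U g (J v) = J (U g v)"
    and \<Gamma>: "group \<Gamma>" and \<pi>: "\<pi> \<in> hom \<Gamma> G"
    and \<omega>_mult: "\<And>g h. g \<in> carrier \<Gamma> \<Longrightarrow> h \<in> carrier \<Gamma> \<Longrightarrow> \<omega> (g \<otimes>\<^bsub>\<Gamma>\<^esub> h) = \<omega> g * \<omega> h"
    and \<omega>_norm: "\<And>g. g \<in> carrier \<Gamma> \<Longrightarrow> norm (\<omega> g) = 1"
begin

text \<open>
  \<open>J\<close> makes the Hilbert space complex and \<open>U\<close> complex linear; the representation below is
  \<open>h \<mapsto> \<omega>(h) U(\<pi>(h))\<close>.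
\<close>

definition twisted_representation :: "'a \<Rightarrow> 'h \<Rightarrow> 'h" where
  "twisted_representation h v = Re (\<omega> h) *\<^sub>R U (\<pi> h) v + Im (\<omega> h) *\<^sub>R J (U (\<pi> h) v)"

text \<open>An isometry with square -1 is skew-adjoint.\<close>

lemma inner_complex_structure: "J v \<bullet> w = - (v \<bullet> J w)" "v \<bullet> J v = 0"
proof -
  show *: "J v \<bullet> w = - (v \<bullet> J w)" for v w
    using linear_isometry_inner[OF J, of v "J w"] by (simp add: JJ)
  show "v \<bullet> J v = 0"
    using *[of v v] by (simp add: inner_commute)
qed

lemma \<pi>_carrier: "h \<in> carrier \<Gamma> \<Longrightarrow> \<pi> h \<in> carrier G"
  using \<pi> by (auto simp: hom_def)

text \<open>\<open>J\<close> commutes with \<open>U\<close> and has square -1, so real and imaginary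
  parts combine as in complex multiplication. Norms are preserved because \<open>?u\<close> and
  \<open>J ?u\<close> are orthogonal and of equal length.\<close>

lemma linear_isometric_action_twisted: "linear_isometric_action \<Gamma> twisted_representation"
proof (rule linear_isometric_actionI[OF \<Gamma>])
  interpret group \<Gamma> by (rule \<Gamma>)
  interpret \<pi>: group_hom \<Gamma> G \<pi>
    using \<Gamma> \<pi> linear_isometric_actionD(1)[OF U] by (simp add: group_hom_def group_hom_axioms_def)
  have linJ: "linear J"
    using J by (rule linear_isometry_linear)
  show "linear_isometry (twisted_representation h)" if h: "h \<in> carrier \<Gamma>" for h
  proof -
    have isoU: "linear_isometry (U (\<pi> h))"
      using linear_isometric_actionD(2)[OF U] h by simp
    have "(norm (twisted_representation h v))\<^sup>2 = (norm v)\<^sup>2" for v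
    proof -
      let ?u = "U (\<pi> h) v"
      have "(norm (twisted_representation h v))\<^sup>2 = ((Re (\<omega> h))\<^sup>2 + (Im (\<omega> h))\<^sup>2) * (?u \<bullet> ?u)"
        unfolding power2_norm_eq_inner twisted_representation_def
        by (simp add: inner_add_left inner_add_right linear_isometry_inner[OF J] inner_complex_structure JJ
            algebra_simps power2_eq_square)
      also have "(Re (\<omega> h))\<^sup>2 + (Im (\<omega> h))\<^sup>2 = 1"
        using \<omega>_norm[OF h] by (metis cmod_power2 one_power2)
      finally show ?thesis
        by (simp add: linear_isometry_inner[OF isoU] power2_norm_eq_inner)
    qed
    moreover have "linear (twisted_representation h)"
      unfolding twisted_representation_def using linear_isometry_linear[OF isoU] linJ
      by (intro linearI) (simp_all add: linear_add linear_scale algebra_simps)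
    ultimately show ?thesis
      by (simp add: linear_isometry_def power2_eq_iff_nonneg)
  qed
  \<comment> \<open>Multiplicativity makes the value at the identity idempotent, and modulus 1
    excludes 0.\<close>
  have "\<omega> \<one>\<^bsub>\<Gamma>\<^esub> * \<omega> \<one>\<^bsub>\<Gamma>\<^esub> = \<omega> \<one>\<^bsub>\<Gamma>\<^esub>" "\<omega> \<one>\<^bsub>\<Gamma>\<^esub> \<noteq> 0"
    using \<omega>_mult[of "\<one>\<^bsub>\<Gamma>\<^esub>" "\<one>\<^bsub>\<Gamma>\<^esub>"] \<omega>_norm[of "\<one>\<^bsub>\<Gamma>\<^esub>"] by auto
  then have "\<omega> \<one>\<^bsub>\<Gamma>\<^esub> = 1"
    by simp
  then show "twisted_representation \<one>\<^bsub>\<Gamma>\<^esub> v = v" for v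
    by (simp add: twisted_representation_def linear_isometric_actionD(3)[OF U])
  show "twisted_representation (g \<otimes>\<^bsub>\<Gamma>\<^esub> h) v = twisted_representation g (twisted_representation h v)"
    if "g \<in> carrier \<Gamma>" "h \<in> carrier \<Gamma>" for g h v
  proof -
    have linU: "linear (U (\<pi> g))"
      using linear_isometric_actionD(2)[OF U] that by (intro linear_isometry_linear) simp
    show ?thesis
      using that
      by (simp add: twisted_representation_def \<omega>_mult linear_isometric_actionD(4)[OF U] UJ JJ
          linear_add[OF linU] linear_scale[OF linU] linear_add[OF linJ] linear_scale[OF linJ] algebra_simps)
  qed
qed

text \<open>A twisted coefficient is bounded by two untwisted ones, against \<open>w\<close> and
  against \<open>J w\<close>. It can be large only over finitely many values of
  \<open>\<pi>\<close>, each with a finite fibre.\<close>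

lemma mixing_twisted:
  assumes mix: "mixing G U" and fib: "\<And>g. finite {h \<in> carrier \<Gamma>. \<pi> h = g}"
  shows "mixing \<Gamma> twisted_representation"
  unfolding mixing_def
proof (intro allI impI)
  fix v w and \<epsilon> :: real assume "\<epsilon> > 0"
  let ?S = "{g \<in> carrier G. \<epsilon> / 2 \<le> \<bar>U g v \<bullet> w\<bar>} \<union> {g \<in> carrier G. \<epsilon> / 2 \<le> \<bar>U g v \<bullet> J w\<bar>}"
  show "finite {h \<in> carrier \<Gamma>. \<epsilon> \<le> \<bar>twisted_representation h v \<bullet> w\<bar>}"
  proof (rule finite_subset)
    show "{h \<in> carrier \<Gamma>. \<epsilon> \<le> \<bar>twisted_representation h v \<bullet> w\<bar>} \<subseteq> (\<Union>g\<in>?S. {h \<in> carrier \<Gamma>. \<pi> h = g})"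
    proof clarify
      fix h assume h: "h \<in> carrier \<Gamma>" "\<epsilon> \<le> \<bar>twisted_representation h v \<bullet> w\<bar>"
      let ?u = "U (\<pi> h) v"
      have "\<bar>Re (\<omega> h)\<bar> \<le> 1" "\<bar>Im (\<omega> h)\<bar> \<le> 1"
        using abs_Re_le_cmod[of "\<omega> h"] abs_Im_le_cmod[of "\<omega> h"] \<omega>_norm[OF h(1)] by simp_all
      then have "\<bar>Re (\<omega> h)\<bar> * \<bar>?u \<bullet> w\<bar> + \<bar>Im (\<omega> h)\<bar> * \<bar>?u \<bullet> J w\<bar> \<le> \<bar>?u \<bullet> w\<bar> + \<bar>?u \<bullet> J w\<bar>"
        by (intro add_mono mult_left_le_one_le) auto
      moreover have "twisted_representation h v \<bullet> w = Re (\<omega> h) * (?u \<bullet> w) - Im (\<omega> h) * (?u \<bullet> J w)"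
        by (simp add: twisted_representation_def inner_add_left inner_complex_structure(1))
      ultimately have "\<epsilon> \<le> \<bar>?u \<bullet> w\<bar> + \<bar>?u \<bullet> J w\<bar>"
        using h(2) abs_triangle_ineq4[of "Re (\<omega> h) * (?u \<bullet> w)" "Im (\<omega> h) * (?u \<bullet> J w)"]
        by (simp add: abs_mult)
      then have "\<pi> h \<in> ?S"
        using \<pi>_carrier[OF h(1)] by auto
      then show "h \<in> (\<Union>g\<in>?S. {h \<in> carrier \<Gamma>. \<pi> h = g})"
        using h(1) by blast
    qed
    show "finite (\<Union>g\<in>?S. {h \<in> carrier \<Gamma>. \<pi> h = g})"
      using mixingD[OF mix half_gt_zero[OF \<open>\<epsilon> > 0\<close>]] fib by (intro finite_UN_I finite_UnI)
  qed
qed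

text \<open>For infinite order mixing excludes fixed vectors. An element of finite order has trivial
  image in the torsion-free \<open>G\<close>, so it acts as the scalar \<open>\<omega> h\<close>,
  which differs from 1.\<close>

lemma twisted_free:
  assumes mix: "mixing G U" and fib: "\<And>g. finite {h \<in> carrier \<Gamma>. \<pi> h = g}"
    and tf: "torsion_free G"
    and inj: "\<And>h. h \<in> carrier \<Gamma> \<Longrightarrow> \<pi> h = \<one>\<^bsub>G\<^esub> \<Longrightarrow> \<omega> h = 1 \<Longrightarrow> h = \<one>\<^bsub>\<Gamma>\<^esub>"
    and h: "h \<in> carrier \<Gamma>" "h \<noteq> \<one>\<^bsub>\<Gamma>\<^esub>" and "v \<noteq> 0"
  shows "twisted_representation h v \<noteq> v"
proof (cases "\<exists>n::nat. n > 0 \<and> h [^]\<^bsub>\<Gamma>\<^esub> n = \<one>\<^bsub>\<Gamma>\<^esub>")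
  case False
  then show ?thesis
    using mixing_no_fixed_vector[OF linear_isometric_action_twisted mixing_twisted[OF mix fib] h(1) _ \<open>v \<noteq> 0\<close>]
    by blast
next
  case True
  interpret \<pi>: group_hom \<Gamma> G \<pi>
    using \<Gamma> \<pi> linear_isometric_actionD(1)[OF U] by (simp add: group_hom_def group_hom_axioms_def)
  obtain n :: nat where n: "n > 0" "h [^]\<^bsub>\<Gamma>\<^esub> n = \<one>\<^bsub>\<Gamma>\<^esub>"
    using True by blast
  then have "\<pi> h [^]\<^bsub>G\<^esub> n = \<one>\<^bsub>G\<^esub>"
    using \<pi>.hom_nat_pow[OF h(1), of n] by simp
  then have one: "\<pi> h = \<one>\<^bsub>G\<^esub>"
    using tf n(1) \<pi>_carrier[OF h(1)] by (auto simp: torsion_free_def)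
  show ?thesis
  proof
    assume eq: "twisted_representation h v = v"
    \<comment> \<open>The \<open>J\<close> part is orthogonal to \<open>v\<close>, so a fixed vector
      forces real part 1, and modulus 1 then leaves no imaginary part.\<close>
    have "v \<bullet> v = twisted_representation h v \<bullet> v"
      by (simp add: eq)
    also have "\<dots> = Re (\<omega> h) * (v \<bullet> v)"
      by (simp add: twisted_representation_def one linear_isometric_actionD(3)[OF U] inner_add_left
          inner_complex_structure)
    finally have "Re (\<omega> h) = 1"
      using \<open>v \<noteq> 0\<close> by simp
    moreover from this have "Im (\<omega> h) = 0"
      using \<omega>_norm[OF h(1)] by (simp add: cmod_def)
    ultimately have "\<omega> h = 1"
      by (simp add: complex_eq_iff)
    then show False
      using inj h one by blast
  qed
qed

end


subsection \<open>The obstruction to proper discontinuity\<close>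

text \<open>Otherwise the fixed space contains an orthonormal \<open>p\<close>-frame. That frame is
  a fixed point of \<open>g\<close> and lies in both \<open>U\<close> and its image for every
  neighbourhood \<open>U\<close>.\<close>

lemma properly_discontinuous_stiefel_finite_dimensional_fixed_space:
  fixes \<rho> :: "'a \<Rightarrow> 'h::real_inner \<Rightarrow> 'h"
  assumes act: "linear_isometric_action \<Gamma> \<rho>"
    and pd: "properly_discontinuous_action \<Gamma>
      (stiefel_topology :: ((real, 'p::finite) vec \<Rightarrow>\<^sub>L 'h) topology)
      stiefel_diffeos (induced_stiefel_action \<rho>)"
    and g: "g \<in> carrier \<Gamma>" "g \<noteq> \<one>\<^bsub>\<Gamma>\<^esub>"
  shows "\<exists>E. finite E \<and> {v. \<rho> g v = v} \<subseteq> span E"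
proof (rule ccontr)
  assume "\<not> ?thesis"
  then have inf: "\<not> {v. \<rho> g v = v} \<subseteq> span E" if "finite E" for E
    using that by simp
  have lin: "linear (\<rho> g)"
    by (rule linear_isometry_linear[OF linear_isometric_actionD(2)[OF act g(1)]])
  then have sub: "subspace {v. \<rho> g v = v}"
    by (auto simp: subspace_def linear_0 linear_add linear_scale)
  have "\<exists>E\<subseteq>{v. \<rho> g v = v}. finite E \<and> card E = CARD('p) \<and> pairwise orthogonal E \<and> (\<forall>e\<in>E. norm e = 1)"
    by (rule orthonormal_set_in_infinite_dimensional_subspace[OF sub inf])
  then obtain E where E: "E \<subseteq> {v. \<rho> g v = v}" "finite E" "card E = CARD('p)" "pairwise orthogonal E"
    "\<forall>e\<in>E. norm e = 1"
    by (elim exE conjE)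
  have "norm e = 1" if "e \<in> E" for e
    using E(5) that by (rule bspec)
  then obtain x :: "(real, 'p) vec \<Rightarrow>\<^sub>L 'h"
    where x: "x \<in> stiefel" "range (blinfun_apply x) = span E"
    by (rule orthonormal_set_in_stiefel[OF E(2-4)])
  have "span E \<subseteq> {v. \<rho> g v = v}"
    using E(1) sub by (rule span_minimal)
  moreover have "blinfun_apply x v \<in> span E" for v
    unfolding x(2)[symmetric] by (rule rangeI)
  ultimately have "\<rho> g (blinfun_apply x v) = blinfun_apply x v" for v
    by blast
  then have "frame_action \<rho> g x = x"
    by (intro blinfun_eqI) (simp add: frame_action_apply[OF act g(1)])
  then have fixed: "induced_stiefel_action \<rho> g x = x"
    using induced_stiefel_action_eq[OF act g(1) x(1)] by simp
  have "x \<in> topspace stiefel_topology"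
    using x(1) by (simp add: stiefel_topology_def)
  moreover have "\<forall>x\<in>topspace stiefel_topology. \<exists>U. openin stiefel_topology U \<and> x \<in> U \<and>
      (\<forall>g\<in>carrier \<Gamma>. g \<noteq> \<one>\<^bsub>\<Gamma>\<^esub> \<longrightarrow> (induced_stiefel_action \<rho> g ::
        ((real, 'p) vec \<Rightarrow>\<^sub>L 'h) \<Rightarrow> _) ` U \<inter> U = {})"
    using pd unfolding properly_discontinuous_action_def by (elim conjE)
  ultimately have "\<exists>U. openin stiefel_topology U \<and> x \<in> U \<and>
      (\<forall>g\<in>carrier \<Gamma>. g \<noteq> \<one>\<^bsub>\<Gamma>\<^esub> \<longrightarrow> induced_stiefel_action \<rho> g ` U \<inter> U = {})"
    by (rule bspec[rotated])
  then obtain U where xU: "x \<in> U"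
    and U: "\<forall>g\<in>carrier \<Gamma>. g \<noteq> \<one>\<^bsub>\<Gamma>\<^esub> \<longrightarrow> induced_stiefel_action \<rho> g ` U \<inter> U = {}"
    by (elim exE conjE)
  have "x \<in> induced_stiefel_action \<rho> g ` U"
    using fixed xU by (metis imageI)
  moreover have "induced_stiefel_action \<rho> g ` U \<inter> U = {}"
    using bspec[OF U g(1)] g(2) by (rule mp)
  ultimately show False
    using xU by (metis IntI emptyE)
qed

text \<open>Multiplication by a unit permutes the residues modulo \<open>q\<close>.\<close>

lemma sum_mult_mod_reindex:
  fixes f :: "nat \<Rightarrow> 'a::comm_monoid_add"
  assumes per: "\<And>n. f (n mod q) = f n" and "coprime i q" and "q > 0"
  shows "(\<Sum>j<q. f (i * j)) = (\<Sum>j<q. f j)"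
proof -
  have inj: "inj_on (\<lambda>j. i * j mod q) {..<q}"
  proof (rule inj_onI)
    fix j l assume jl: "j \<in> {..<q}" "l \<in> {..<q}" "i * j mod q = i * l mod q"
    then have "[i * j = i * l] (mod q)"
      by (simp add: cong_def)
    then have "[j = l] (mod q)"
      using \<open>coprime i q\<close> by (simp add: cong_mult_lcancel_nat)
    then show "j = l"
      using jl by (simp add: cong_def)
  qed
  moreover have "(\<lambda>j. i * j mod q) ` {..<q} \<subseteq> {..<q}"
    using \<open>q > 0\<close> by auto
  ultimately have "(\<lambda>j. i * j mod q) ` {..<q} = {..<q}"
    by (intro card_subset_eq) (auto simp: card_image)
  then have "(\<Sum>j<q. f j) = (\<Sum>j<q. f (i * j mod q))"
    using inj by (intro sum.reindex_cong) auto
  then show ?thesis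
    by (simp add: per)
qed

text \<open>In \<open>\<int>\<^sub>q \<times> \<int>\<^sub>q\<close> the \<open>q + 1\<close> subgroups of order \<open>q\<close> cover every nontrivial element once, so
  the identity is a rational combination of the orbit sums over these subgroups and over the
  whole group. Hence the fixed spaces of finitely many nontrivial elements span everything.\<close>

lemma noncyclic_elementary_abelian_fixed_spaces_span:
  fixes \<rho> :: "'a \<Rightarrow> 'h::real_inner \<Rightarrow> 'h"
  assumes act: "linear_isometric_action \<Gamma> \<rho>" and q: "prime (q::nat)"
    and a: "a \<in> carrier \<Gamma>" and b: "b \<in> carrier \<Gamma>" and comm: "a \<otimes>\<^bsub>\<Gamma>\<^esub> b = b \<otimes>\<^bsub>\<Gamma>\<^esub> a"
    and aq: "a [^]\<^bsub>\<Gamma>\<^esub> q = \<one>\<^bsub>\<Gamma>\<^esub>" and bq: "b [^]\<^bsub>\<Gamma>\<^esub> q = \<one>\<^bsub>\<Gamma>\<^esub>"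
  shows "v \<in> span ({u. \<rho> b u = u} \<union> (\<Union>j<q. {u. \<rho> (a \<otimes>\<^bsub>\<Gamma>\<^esub> b [^]\<^bsub>\<Gamma>\<^esub> j) u = u}))"
proof -
  interpret group \<Gamma>
    by (rule linear_isometric_actionD[OF act])
  note mult = linear_isometric_actionD(4)[OF act] and one = linear_isometric_actionD(3)[OF act]
  have lin: "linear (\<rho> g)" if "g \<in> carrier \<Gamma>" for g
    by (rule linear_isometry_linear[OF linear_isometric_actionD(2)[OF act that]])
  have q0: "q > 0"
    using q by (rule prime_gt_0_nat)
  \<comment> \<open>When \<open>c\<close> has \<open>q\<close>-th power the identity, this is
    \<open>q\<close> times the orthogonal projection onto the fixed space of
    \<open>c\<close>.\<close>
  define P where "P c v = (\<Sum>i<q. \<rho> (c [^]\<^bsub>\<Gamma>\<^esub> i) v)" for c v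
  have P_fixed: "\<rho> c (P c v) = P c v" if c: "c \<in> carrier \<Gamma>" "c [^]\<^bsub>\<Gamma>\<^esub> q = \<one>\<^bsub>\<Gamma>\<^esub>" for c v
  proof -
    have "\<rho> c (P c v) = (\<Sum>i<q. \<rho> (c [^]\<^bsub>\<Gamma>\<^esub> Suc i) v)"
      by (simp only: P_def linear_sum[OF lin[OF c(1)]] nat_pow_Suc2[OF c(1)]
          mult[OF c(1) nat_pow_closed[OF c(1)]])
    also have "\<dots> = P c v + \<rho> (c [^]\<^bsub>\<Gamma>\<^esub> q) v - \<rho> (c [^]\<^bsub>\<Gamma>\<^esub> (0::nat)) v"
      unfolding P_def using sum.lessThan_Suc_shift[of "\<lambda>i. \<rho> (c [^]\<^bsub>\<Gamma>\<^esub> i) v" q] by simp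
    finally show ?thesis
      using c(2) by simp
  qed
  \<comment> \<open>In the model case of a copy of Z_q x Z_q generated by \<open>a\<close> and
    \<open>b\<close>, these generate the \<open>q\<close> subgroups of order \<open>q\<close> other
    than that of \<open>b\<close>.\<close>
  define c where "c j = a \<otimes>\<^bsub>\<Gamma>\<^esub> b [^]\<^bsub>\<Gamma>\<^esub> j" for j :: nat
  have cc: "c j \<in> carrier \<Gamma>" for j
    using a b by (simp add: c_def)
  have comm': "a \<otimes>\<^bsub>\<Gamma>\<^esub> b [^]\<^bsub>\<Gamma>\<^esub> j = b [^]\<^bsub>\<Gamma>\<^esub> j \<otimes>\<^bsub>\<Gamma>\<^esub> a" for j :: nat
    using group_commutes_pow[OF comm[symmetric] b a] by simp
  have c_pow: "c j [^]\<^bsub>\<Gamma>\<^esub> i = a [^]\<^bsub>\<Gamma>\<^esub> i \<otimes>\<^bsub>\<Gamma>\<^esub> b [^]\<^bsub>\<Gamma>\<^esub> (i * j)" for i j :: nat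
    by (simp only: c_def pow_mult_distrib[OF comm' a nat_pow_closed[OF b]] nat_pow_pow[OF b] mult.commute)
  have cq: "c j [^]\<^bsub>\<Gamma>\<^esub> q = \<one>\<^bsub>\<Gamma>\<^esub>" for j
    by (simp only: c_pow aq bq nat_pow_pow[OF b, symmetric] nat_pow_one r_one one_closed)
  have per: "\<rho> (b [^]\<^bsub>\<Gamma>\<^esub> (n mod q)) v = \<rho> (b [^]\<^bsub>\<Gamma>\<^esub> n) v" for n
  proof -
    have "b [^]\<^bsub>\<Gamma>\<^esub> n = b [^]\<^bsub>\<Gamma>\<^esub> (q * (n div q) + n mod q)"
      by simp
    also have "\<dots> = b [^]\<^bsub>\<Gamma>\<^esub> (n mod q)"
      using b by (simp only: nat_pow_mult[symmetric] nat_pow_pow[symmetric] bq nat_pow_one l_one nat_pow_closed)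
    finally show ?thesis
      by simp
  qed
  have inner: "(\<Sum>j<q. \<rho> (b [^]\<^bsub>\<Gamma>\<^esub> (i * j)) v) = P b v" if "i \<in> {..<q} - {0}" for i
  proof -
    have "\<not> q dvd i"
      using that by (auto dest: dvd_imp_le)
    then have "coprime i q"
      using prime_imp_coprime[OF q] by (simp add: coprime_commute)
    then show ?thesis
      unfolding P_def
      by (rule sum_mult_mod_reindex[where f="\<lambda>n. \<rho> (b [^]\<^bsub>\<Gamma>\<^esub> n) v", OF per _ q0])
  qed
  have "(\<Sum>j<q. P (c j) v) = (\<Sum>i<q. \<Sum>j<q. \<rho> (a [^]\<^bsub>\<Gamma>\<^esub> i) (\<rho> (b [^]\<^bsub>\<Gamma>\<^esub> (i * j)) v))"
    unfolding P_def by (subst sum.swap) (simp add: c_pow mult a b)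
  also have "\<dots> = (\<Sum>i<q. \<rho> (a [^]\<^bsub>\<Gamma>\<^esub> i) (\<Sum>j<q. \<rho> (b [^]\<^bsub>\<Gamma>\<^esub> (i * j)) v))"
    using a by (simp add: linear_sum[OF lin])
  \<comment> \<open>The term \<open>i = 0\<close> contributes \<open>q\<close> copies of
    \<open>v\<close>. In every other term the inner sum is the full orbit sum over the powers of
    \<open>b\<close>, since \<open>i\<close> is invertible modulo the prime
    \<open>q\<close>.\<close>
  also have "\<dots> = real q *\<^sub>R v + (\<Sum>i\<in>{..<q} - {0}. \<rho> (a [^]\<^bsub>\<Gamma>\<^esub> i) (\<Sum>j<q. \<rho> (b [^]\<^bsub>\<Gamma>\<^esub> (i * j)) v))"
    using q0 by (subst sum.remove[of _ 0]) (auto simp: one sum_constant_scaleR)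
  also have "(\<Sum>i\<in>{..<q} - {0}. \<rho> (a [^]\<^bsub>\<Gamma>\<^esub> i) (\<Sum>j<q. \<rho> (b [^]\<^bsub>\<Gamma>\<^esub> (i * j)) v))
      = (\<Sum>i\<in>{..<q} - {0}. \<rho> (a [^]\<^bsub>\<Gamma>\<^esub> i) (P b v))"
    by (rule sum.cong[OF refl]) (simp only: inner)
  finally have eq: "real q *\<^sub>R v = (\<Sum>j<q. P (c j) v) - (\<Sum>i\<in>{..<q} - {0}. \<rho> (a [^]\<^bsub>\<Gamma>\<^esub> i) (P b v))"
    by simp
  let ?S = "{u. \<rho> b u = u} \<union> (\<Union>j<q. {u. \<rho> (a \<otimes>\<^bsub>\<Gamma>\<^esub> b [^]\<^bsub>\<Gamma>\<^esub> j) u = u})"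
  have "P (c j) v \<in> span ?S" if "j < q" for j
    using P_fixed[OF cc cq] that by (intro span_base) (auto simp: c_def)
  moreover have "\<rho> (a [^]\<^bsub>\<Gamma>\<^esub> i) (P b v) \<in> span ?S" for i :: nat
  proof -
    \<comment> \<open>Powers of \<open>a\<close> commute with \<open>b\<close>, so they preserve its
      fixed space.\<close>
    have "b \<otimes>\<^bsub>\<Gamma>\<^esub> a [^]\<^bsub>\<Gamma>\<^esub> i = a [^]\<^bsub>\<Gamma>\<^esub> i \<otimes>\<^bsub>\<Gamma>\<^esub> b"
      using group_commutes_pow[OF comm a b, of i] by simp
    then have "\<rho> b (\<rho> (a [^]\<^bsub>\<Gamma>\<^esub> i) (P b v)) = \<rho> (a [^]\<^bsub>\<Gamma>\<^esub> i) (\<rho> b (P b v))"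
      using a b by (simp flip: mult)
    then show ?thesis
      using P_fixed[OF b bq] by (intro span_base) auto
  qed
  ultimately have "real q *\<^sub>R v \<in> span ?S"
    unfolding eq by (intro span_diff span_sum) auto
  then have "(1 / real q) *\<^sub>R real q *\<^sub>R v \<in> span ?S"
    by (rule span_scale)
  then show ?thesis
    using q0 by simp
qed

text \<open>The \<open>q + 1\<close> elements whose fixed spaces span are nontrivial, so each fixed
  space would lie in a finite span; the union of these finite sets would then span the
  infinite-dimensional space.\<close>

lemma no_properly_discontinuous_stiefel_action:
  fixes \<rho> :: "'a \<Rightarrow> 'h::real_inner \<Rightarrow> 'h"
  assumes inf: "infinite_dimensional TYPE('h)"
    and act: "linear_isometric_action \<Gamma> \<rho>" and q: "prime (q::nat)"
    and a: "a \<in> carrier \<Gamma>" and b: "b \<in> carrier \<Gamma>" and comm: "a \<otimes>\<^bsub>\<Gamma>\<^esub> b = b \<otimes>\<^bsub>\<Gamma>\<^esub> a"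
    and aq: "a [^]\<^bsub>\<Gamma>\<^esub> q = \<one>\<^bsub>\<Gamma>\<^esub>" and bq: "b [^]\<^bsub>\<Gamma>\<^esub> q = \<one>\<^bsub>\<Gamma>\<^esub>"
    and nt: "b \<noteq> \<one>\<^bsub>\<Gamma>\<^esub>" "\<And>j::nat. a \<otimes>\<^bsub>\<Gamma>\<^esub> b [^]\<^bsub>\<Gamma>\<^esub> j \<noteq> \<one>\<^bsub>\<Gamma>\<^esub>"
  shows "\<not> properly_discontinuous_action \<Gamma>
      (stiefel_topology :: ((real, 'p::finite) vec \<Rightarrow>\<^sub>L 'h) topology)
      stiefel_diffeos (induced_stiefel_action \<rho>)"
proof
  assume pd: "properly_discontinuous_action \<Gamma>
      (stiefel_topology :: ((real, 'p::finite) vec \<Rightarrow>\<^sub>L 'h) topology)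
      stiefel_diffeos (induced_stiefel_action \<rho>)"
  note fin = properly_discontinuous_stiefel_finite_dimensional_fixed_space[OF act pd]
  interpret group \<Gamma>
    by (rule linear_isometric_actionD[OF act])
  obtain E where E: "finite E" "{v. \<rho> b v = v} \<subseteq> span E"
    using fin[OF b nt(1)] by blast
  have "\<forall>j. \<exists>E. finite E \<and> {v. \<rho> (a \<otimes>\<^bsub>\<Gamma>\<^esub> b [^]\<^bsub>\<Gamma>\<^esub> (j::nat)) v = v} \<subseteq> span E"
    using a b nt(2) by (intro allI fin) auto
  then obtain F where F: "\<And>j. finite (F j)"
    "\<And>j::nat. {v. \<rho> (a \<otimes>\<^bsub>\<Gamma>\<^esub> b [^]\<^bsub>\<Gamma>\<^esub> j) v = v} \<subseteq> span (F j)"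
    by metis
  let ?E = "E \<union> (\<Union>j<q. F j)"
  have "{u. \<rho> b u = u} \<union> (\<Union>j<q. {u. \<rho> (a \<otimes>\<^bsub>\<Gamma>\<^esub> b [^]\<^bsub>\<Gamma>\<^esub> j) u = u}) \<subseteq> span ?E"
  proof (intro Un_least UN_least)
    show "{u. \<rho> b u = u} \<subseteq> span ?E"
      using E(2) span_mono[of E ?E] by blast
    show "{u. \<rho> (a \<otimes>\<^bsub>\<Gamma>\<^esub> b [^]\<^bsub>\<Gamma>\<^esub> j) u = u} \<subseteq> span ?E" if "j \<in> {..<q}" for j
      using F(2)[of j] span_mono[of "F j" ?E] that by blast
  qed
  then have "span ({u. \<rho> b u = u} \<union> (\<Union>j<q. {u. \<rho> (a \<otimes>\<^bsub>\<Gamma>\<^esub> b [^]\<^bsub>\<Gamma>\<^esub> j) u = u})) \<subseteq> span ?E"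
    by (intro span_minimal subspace_span)
  then have "v \<in> span ?E" for v
    using noncyclic_elementary_abelian_fixed_spaces_span[OF act q a b comm aq bq] by blast
  then have "span ?E = UNIV"
    by blast
  moreover have "finite ?E"
    using E(1) F(1) by simp
  ultimately show False
    using inf unfolding infinite_dimensional_def by blast
qed


subsection \<open>Faithful characters of products of cyclic groups\<close>

definition cyclic_product_character :: "nat set \<Rightarrow> (nat \<Rightarrow> nat) \<Rightarrow> (nat \<Rightarrow> int) \<Rightarrow> complex" where
  "cyclic_product_character I n x = (\<Prod>i\<in>I. cis (2 * pi * of_int (x i) / of_nat (n i)))"

text \<open>The law of \<open>integer_mod_group\<close> reduces modulo \<open>n\<close>; periodicity
  makes the character insensitive to this.\<close>

lemma cis_mod: "n > 0 \<Longrightarrow> cis (2 * pi * of_int (a mod int n) / of_nat n) = cis (2 * pi * of_int a / of_nat n)"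
proof -
  assume "n > 0"
  have "real_of_int a = of_int (a mod int n) + of_nat n * of_int (a div int n)"
    by (metis mod_mult_div_eq of_int_add of_int_mult of_int_of_nat_eq)
  then have "real_of_int a / of_nat n = of_int (a mod int n) / of_nat n + of_int (a div int n)"
    using \<open>n > 0\<close> by (simp add: add_divide_distrib)
  then have "2 * pi * of_int a / of_nat n = 2 * pi * of_int (a mod int n) / of_nat n + 2 * pi * of_int (a div int n)"
    by (metis distrib_left times_divide_eq_right)
  then show ?thesis
    by (simp flip: cis_mult)
qed

lemma cyclic_product_character_mult:
  assumes "\<And>i. i \<in> I \<Longrightarrow> n i > 0"
  shows "cyclic_product_character I n (x \<otimes>\<^bsub>product_group I (\<lambda>i. integer_mod_group (n i))\<^esub> y)
    = cyclic_product_character I n x * cyclic_product_character I n y"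
  unfolding cyclic_product_character_def prod.distrib[symmetric]
  using assms by (intro prod.cong) (auto simp: cis_mod cis_mult add_divide_distrib distrib_left)

lemma norm_cyclic_product_character: "norm (cyclic_product_character I n x) = 1"
  by (simp add: cyclic_product_character_def prod_norm[symmetric])

text \<open>Value 1 means that the sum of the fractions \<open>x i / n i\<close> is an integer.
  After clearing denominators all terms except the \<open>i\<close>-th are divisible by
  \<open>n i\<close>; the cofactor of \<open>x i\<close> is coprime to \<open>n i\<close>, so
  \<open>n i\<close> divides \<open>x i\<close>, which is a reduced residue and therefore 0.\<close>

lemma cyclic_product_character_eq_1_imp:
  assumes fin: "finite I" and pos: "\<And>i. i \<in> I \<Longrightarrow> n i > 0"
    and cop: "\<And>i j. i \<in> I \<Longrightarrow> j \<in> I \<Longrightarrow> i \<noteq> j \<Longrightarrow> coprime (n i) (n j)"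
    and x: "x \<in> carrier (product_group I (\<lambda>i. integer_mod_group (n i)))"
    and one: "cyclic_product_character I n x = 1"
  shows "x = \<one>\<^bsub>product_group I (\<lambda>i. integer_mod_group (n i))\<^esub>"
proof -
  have "cyclic_product_character I n x = cis (\<Sum>i\<in>I. 2 * pi * of_int (x i) / of_nat (n i))"
    unfolding cyclic_product_character_def using fin by (induction I) (auto simp: cis_mult)
  then have "cos (2 * pi * (\<Sum>i\<in>I. of_int (x i) / of_nat (n i))) = 1"
    using one by (simp add: complex_eq_iff sum_distrib_left)
  then obtain z :: int where "2 * pi * (\<Sum>i\<in>I. of_int (x i) / of_nat (n i)) = of_int z * 2 * pi"
    by (auto simp: cos_one_2pi_int)
  then have z: "(\<Sum>i\<in>I. of_int (x i) / of_nat (n i)) = real_of_int z"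
    by (simp add: mult.commute)
  have "x i = 0" if i: "i \<in> I" for i
  proof -
    define N where "N A = (\<Prod>j\<in>A. int (n j))" for A
    have "of_int (x j) / of_nat (n j) * of_int (N I) = real_of_int (x j * N (I - {j}))" if "j \<in> I" for j
    proof -
      have "N I = int (n j) * N (I - {j})"
        unfolding N_def using fin that by (rule prod.remove)
      then show ?thesis
        using pos[OF that] by simp
    qed
    then have "real_of_int (z * N I) = real_of_int (\<Sum>j\<in>I. x j * N (I - {j}))"
      by (simp add: z[symmetric] sum_distrib_right)
    then have "z * N I = x i * N (I - {i}) + (\<Sum>j\<in>I - {i}. x j * N (I - {j}))"
      using fin i by (simp add: sum.remove flip: of_int_mult of_int_sum)
    moreover have dvd: "int (n i) dvd N A" if "A \<subseteq> I" "i \<in> A" for A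
      unfolding N_def using dvd_prodI[OF finite_subset[OF that(1) fin] that(2), of "\<lambda>j. int (n j)"] .
    moreover have "int (n i) dvd z * N I"
      using dvd[OF subset_refl i] by (rule dvd_mult)
    moreover have "int (n i) dvd (\<Sum>j\<in>I - {i}. x j * N (I - {j}))"
    proof (rule dvd_sum)
      fix j assume "j \<in> I - {i}"
      then show "int (n i) dvd x j * N (I - {j})"
        using i by (intro dvd_mult dvd) auto
    qed
    ultimately have "int (n i) dvd x i * N (I - {i})"
      by (simp add: dvd_add_left_iff)
    moreover have "coprime (int (n i)) (N (I - {i}))"
      unfolding N_def using cop i by (intro prod_coprime_right) auto
    ultimately have "int (n i) dvd x i"
      by (simp add: coprime_dvd_mult_left_iff)
    moreover have "0 \<le> x i" "x i < int (n i)"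
      using x i pos[OF i] by (auto simp: carrier_integer_mod_group PiE_iff)
    ultimately show ?thesis
      by (metis zdvd_not_zless order_le_less)
  qed
  then show ?thesis
    using x by (auto simp: PiE_iff extensional_def)
qed


subsection \<open>Groups with cyclic factors\<close>

text \<open>Cardinal absorption; it lets complex l^2(G) have the same real dimension as real
  l^2(G).\<close>

lemma infinite_times_bool_eqpoll:
  assumes "infinite A"
  shows "A \<times> (UNIV :: bool set) \<approx> A"
proof -
  have "ordLeq3 (card_of (UNIV :: bool set)) (card_of A)"
    using finite_lepoll_infinite[OF assms, of "UNIV :: bool set"] by (simp add: lepoll_def card_of_ordLeq)
  then show ?thesis
    using assms by (simp add: eqpoll_iff_card_of_ordIso card_of_Times_infinite)
qed

text \<open>The parameter \<open>e\<close> is always the identity of \<open>G\<close>. The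
  restriction to \<open>I\<close> is required by the extensional carrier of
  \<open>product_group\<close>.\<close>

definition coordinate_embedding :: "nat set \<Rightarrow> 'g \<Rightarrow> nat \<Rightarrow> int \<Rightarrow> 'g \<times> (nat \<Rightarrow> int)" where
  "coordinate_embedding I e i t = (e, \<lambda>m\<in>I. if m = i then t else 0)"

lemma coordinate_embedding_hom:
  assumes "group G" and "i \<in> I"
  shows "coordinate_embedding I \<one>\<^bsub>G\<^esub> i
    \<in> hom (integer_mod_group (n i)) (G \<times>\<times> product_group I (\<lambda>i. integer_mod_group (n i)))"
  using assms by (intro homI)
    (auto simp: coordinate_embedding_def fun_eq_iff group.is_monoid monoid.one_closed)

lemma coordinate_embedding_commute:
  assumes "i \<noteq> j"
  shows "coordinate_embedding I \<one>\<^bsub>G\<^esub> i s \<otimes>\<^bsub>G \<times>\<times> product_group I (\<lambda>i. integer_mod_group (n i))\<^esub> coordinate_embedding I \<one>\<^bsub>G\<^esub> j t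
    = coordinate_embedding I \<one>\<^bsub>G\<^esub> j t \<otimes>\<^bsub>G \<times>\<times> product_group I (\<lambda>i. integer_mod_group (n i))\<^esub> coordinate_embedding I \<one>\<^bsub>G\<^esub> i s"
  using assms by (auto simp: coordinate_embedding_def fun_eq_iff)

lemma noncyclic_product_no_properly_discontinuous_stiefel_action:
  fixes \<rho> :: "'a \<Rightarrow> 'h::real_inner \<Rightarrow> 'h" and q \<alpha> :: "nat \<Rightarrow> nat"
  assumes inf: "infinite_dimensional TYPE('h)" and act: "linear_isometric_action H \<rho>"
    and G: "group G" and iso: "H \<cong> G \<times>\<times> product_group I (\<lambda>i. integer_mod_group (q i ^ \<alpha> i))"
    and ij: "i \<in> I" "j \<in> I" "i \<noteq> j" "q i = q j" and q: "prime (q i)"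
    and \<alpha>: "\<alpha> i \<ge> 1" "\<alpha> j \<ge> 1"
  shows "\<not> properly_discontinuous_action H
      (stiefel_topology :: ((real, 'p::finite) vec \<Rightarrow>\<^sub>L 'h) topology)
      stiefel_diffeos (induced_stiefel_action \<rho>)"
proof -
  let ?Z = "\<lambda>i. integer_mod_group (q i ^ \<alpha> i)"
  let ?P = "G \<times>\<times> product_group I ?Z"
  have H: "group H"
    by (rule linear_isometric_actionD[OF act])
  have P: "group ?P"
    using G by (intro DirProd_group) auto
  obtain \<psi> where \<psi>: "\<psi> \<in> iso ?P H"
    using iso group.iso_sym[OF H] unfolding is_iso_def by blast
  then have \<psi>_hom: "\<psi> \<in> hom ?P H" and \<psi>_inj: "inj_on \<psi> (carrier ?P)"
    by (auto simp: iso_def bij_betw_def)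
  interpret \<psi>: group_hom ?P H \<psi>
    using H P \<psi>_hom by (simp add: group_hom_def group_hom_axioms_def)
  \<comment> \<open>This residue has order exactly \<open>q m\<close> in the cyclic group of order
    \<open>q m ^ \<alpha> m\<close>.\<close>
  define t where "t m = int (q m ^ (\<alpha> m - 1))" for m
  define c where "c m = coordinate_embedding I \<one>\<^bsub>G\<^esub> m (t m)" for m
  have c: "c m \<in> carrier ?P" "c m [^]\<^bsub>?P\<^esub> l = coordinate_embedding I \<one>\<^bsub>G\<^esub> m (int l * t m mod int (q m ^ \<alpha> m))"
    "c m [^]\<^bsub>?P\<^esub> q m = \<one>\<^bsub>?P\<^esub>" "0 < t m" "t m < int (q m ^ \<alpha> m)"
    if m: "m \<in> I" "\<alpha> m \<ge> 1" "prime (q m)" for m and l :: nat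
  proof -
    have q1: "q m > 1"
      using m(3) by (rule prime_gt_1_nat)
    have e: "q m ^ \<alpha> m = q m * q m ^ (\<alpha> m - 1)"
      using m(2) by (metis power_minus_mult mult.commute zero_less_one order_less_le_trans)
    show t: "0 < t m" "t m < int (q m ^ \<alpha> m)"
      using q1 unfolding t_def e by simp_all
    then have tc: "t m \<in> carrier (?Z m)"
      by (simp add: carrier_integer_mod_group)
    have hom: "coordinate_embedding I \<one>\<^bsub>G\<^esub> m \<in> hom (?Z m) ?P"
      by (rule coordinate_embedding_hom[OF G m(1)])
    show "c m \<in> carrier ?P"
      unfolding c_def using hom tc by (rule hom_in_carrier)
    show pow: "c m [^]\<^bsub>?P\<^esub> l = coordinate_embedding I \<one>\<^bsub>G\<^esub> m (int l * t m mod int (q m ^ \<alpha> m))" for l :: nat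
      unfolding c_def using hom_nat_pow[OF hom tc group_integer_mod_group P, of l] by simp
    have "int (q m) * t m = int (q m ^ \<alpha> m)"
      unfolding t_def e by simp
    then show "c m [^]\<^bsub>?P\<^esub> q m = \<one>\<^bsub>?P\<^esub>"
      unfolding pow by (auto simp: coordinate_embedding_def fun_eq_iff)
  qed
  have qj: "prime (q j)"
    using q ij by simp
  note ci = c[OF ij(1) \<alpha>(1) q] and cj = c[OF ij(2) \<alpha>(2) qj]
  \<comment> \<open>The \<open>i\<close>-th coordinate of the product is \<open>t i\<close>,
    untouched by the other factor, and lies strictly between 0 and the modulus.\<close>
  have nt: "c i \<otimes>\<^bsub>?P\<^esub> c j [^]\<^bsub>?P\<^esub> l \<noteq> \<one>\<^bsub>?P\<^esub>" for l :: nat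
  proof
    assume "c i \<otimes>\<^bsub>?P\<^esub> c j [^]\<^bsub>?P\<^esub> l = \<one>\<^bsub>?P\<^esub>"
    then have "snd (c i \<otimes>\<^bsub>?P\<^esub> c j [^]\<^bsub>?P\<^esub> l) i = snd \<one>\<^bsub>?P\<^esub> i"
      by simp
    then show False
      using ij ci(4,5) unfolding cj(2) by (simp add: c_def coordinate_embedding_def)
  qed
  have ntj: "c j \<noteq> \<one>\<^bsub>?P\<^esub>"
  proof
    assume eq: "c j = \<one>\<^bsub>?P\<^esub>"
    have "t j = snd (c j) j"
      using ij(2) by (simp add: c_def coordinate_embedding_def)
    also have "\<dots> = 0"
      using ij(2) by (simp add: eq)
    finally show False
      using cj(4) by simp
  qed
  have one: "\<psi> x \<noteq> \<one>\<^bsub>H\<^esub>" if "x \<in> carrier ?P" "x \<noteq> \<one>\<^bsub>?P\<^esub>" for x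
  proof -
    have "\<psi> x \<noteq> \<psi> \<one>\<^bsub>?P\<^esub>"
      using inj_on_eq_iff[OF \<psi>_inj that(1) \<psi>.G.one_closed] that(2) by blast
    then show ?thesis
      unfolding \<psi>.hom_one .
  qed
  show ?thesis
  proof (rule no_properly_discontinuous_stiefel_action[OF inf act q, of "\<psi> (c i)" "\<psi> (c j)"])
    show "\<psi> (c i) \<in> carrier H" "\<psi> (c j) \<in> carrier H"
      using ci(1) cj(1) by (blast intro: \<psi>.hom_closed)+
    show "\<psi> (c i) \<otimes>\<^bsub>H\<^esub> \<psi> (c j) = \<psi> (c j) \<otimes>\<^bsub>H\<^esub> \<psi> (c i)"
      unfolding \<psi>.hom_mult[OF ci(1) cj(1), symmetric] \<psi>.hom_mult[OF cj(1) ci(1), symmetric]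
      unfolding c_def coordinate_embedding_commute[OF ij(3)] ..
    show "\<psi> (c i) [^]\<^bsub>H\<^esub> q i = \<one>\<^bsub>H\<^esub>"
      unfolding \<psi>.hom_nat_pow[OF ci(1), symmetric] ci(3) by (rule \<psi>.hom_one)
    show "\<psi> (c j) [^]\<^bsub>H\<^esub> q i = \<one>\<^bsub>H\<^esub>"
      unfolding \<psi>.hom_nat_pow[OF cj(1), symmetric] cj(3) ij(4) by (rule \<psi>.hom_one)
    show "\<psi> (c j) \<noteq> \<one>\<^bsub>H\<^esub>"
      using one[OF cj(1) ntj] .
    show "\<psi> (c i) \<otimes>\<^bsub>H\<^esub> \<psi> (c j) [^]\<^bsub>H\<^esub> l \<noteq> \<one>\<^bsub>H\<^esub>" for l :: nat
    proof -
      have "\<psi> (c i \<otimes>\<^bsub>?P\<^esub> c j [^]\<^bsub>?P\<^esub> l) = \<psi> (c i) \<otimes>\<^bsub>H\<^esub> \<psi> (c j) [^]\<^bsub>H\<^esub> l"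
        using ci(1) cj(1) by (simp only: \<psi>.hom_mult \<psi>.hom_nat_pow \<psi>.G.nat_pow_closed)
      then show ?thesis
        using one[OF \<psi>.G.m_closed[OF ci(1) \<psi>.G.nat_pow_closed[OF cj(1)]] nt, of l] by (simp only: not_False_eq_True)
    qed
  qed
qed

text \<open>The isomorphism splits an element of \<open>H\<close> into a component in
  \<open>G\<close>, which translates, and one in the finite product, which acts through the
  character. Finiteness of the product gives the finite fibres that mixing requires, and distinct
  primes give the coprime orders that faithfulness requires.\<close>

lemma cyclic_product_properly_discontinuous_stiefel_action:
  fixes B :: "'h::{real_inner, complete_space} set" and q \<alpha> :: "nat \<Rightarrow> nat"
  assumes G: "group G" and tf: "torsion_free G" and H: "group H" and "finite I"
    and q: "\<And>i. i \<in> I \<Longrightarrow> prime (q i)" and dist: "\<And>i j. i \<in> I \<Longrightarrow> j \<in> I \<Longrightarrow> i \<noteq> j \<Longrightarrow> q i \<noteq> q j"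
    and iso: "H \<cong> G \<times>\<times> product_group I (\<lambda>i. integer_mod_group (q i ^ \<alpha> i))"
    and B: "hilbert_basis B" and e: "bij_betw e (carrier G \<times> (UNIV :: bool set)) B"
  shows "\<exists>\<rho> :: 'a \<Rightarrow> 'h \<Rightarrow> 'h. linear_isometric_action H \<rho> \<and>
            properly_discontinuous_action H
              (stiefel_topology :: ((real, 'p::finite) vec \<Rightarrow>\<^sub>L 'h) topology)
              stiefel_diffeos (induced_stiefel_action \<rho>)"
proof -
  let ?n = "\<lambda>i. q i ^ \<alpha> i"
  let ?Z = "product_group I (\<lambda>i. integer_mod_group (?n i))"
  have pos: "?n i > 0" if "i \<in> I" for i
    using prime_gt_0_nat[OF q[OF that]] by simp
  have cop: "coprime (?n i) (?n j)" if "i \<in> I" "j \<in> I" "i \<noteq> j" for i j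
    using that dist q by (intro coprime_power_left_iff[THEN iffD2] coprime_power_right_iff[THEN iffD2] disjI1 primes_coprime) auto
  obtain \<psi> where \<psi>: "\<psi> \<in> iso H (G \<times>\<times> ?Z)"
    using iso unfolding is_iso_def by blast
  then have hom: "\<psi> \<in> hom H (G \<times>\<times> ?Z)" and inj: "inj_on \<psi> (carrier H)"
    by (auto simp: iso_def bij_betw_def)
  have carr: "\<psi> h \<in> carrier G \<times> carrier ?Z" if "h \<in> carrier H" for h
    using hom_in_carrier[OF hom that] by simp
  have mult: "\<psi> (g \<otimes>\<^bsub>H\<^esub> h) = (fst (\<psi> g) \<otimes>\<^bsub>G\<^esub> fst (\<psi> h), snd (\<psi> g) \<otimes>\<^bsub>?Z\<^esub> snd (\<psi> h))"
    if "g \<in> carrier H" "h \<in> carrier H" for g h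
    using hom_mult[OF hom that] by (simp only: mult_DirProd')
  define \<pi> where "\<pi> h = fst (\<psi> h)" for h
  define \<omega> where "\<omega> h = cyclic_product_character I ?n (snd (\<psi> h))" for h
  have \<pi>: "\<pi> \<in> hom H G"
    using carr mult by (intro homI) (auto simp: \<pi>_def mem_Times_iff)
  have \<omega>_mult: "\<omega> (g \<otimes>\<^bsub>H\<^esub> h) = \<omega> g * \<omega> h" if "g \<in> carrier H" "h \<in> carrier H" for g h
    unfolding \<omega>_def mult[OF that] snd_conv by (rule cyclic_product_character_mult[OF pos])
  have \<omega>_norm: "norm (\<omega> h) = 1" for h
    by (simp add: \<omega>_def norm_cyclic_product_character)
  have "finite (carrier ?Z)"
    using \<open>finite I\<close> pos by (auto simp: carrier_integer_mod_group intro!: finite_PiE)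
  have fib: "finite {h \<in> carrier H. \<pi> h = g}" for g
  proof (rule inj_on_finite)
    show "inj_on \<psi> {h \<in> carrier H. \<pi> h = g}"
      using inj by (rule inj_on_subset) auto
    show "\<psi> ` {h \<in> carrier H. \<pi> h = g} \<subseteq> {g} \<times> carrier ?Z"
    proof (rule image_subsetI)
      fix h assume "h \<in> {h \<in> carrier H. \<pi> h = g}"
      then show "\<psi> h \<in> {g} \<times> carrier ?Z"
        using carr[of h] by (simp add: \<pi>_def mem_Times_iff del: carrier_product_group)
    qed
    show "finite ({g} \<times> carrier ?Z)"
      using \<open>finite (carrier ?Z)\<close> by simp
  qed
  have faithful: "h = \<one>\<^bsub>H\<^esub>" if h: "h \<in> carrier H" "\<pi> h = \<one>\<^bsub>G\<^esub>" "\<omega> h = 1" for h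
  proof -
    have "snd (\<psi> h) = \<one>\<^bsub>?Z\<^esub>"
      using carr[OF h(1)] h(3) unfolding \<omega>_def mem_Times_iff
      by (intro cyclic_product_character_eq_1_imp[where n="?n", OF \<open>finite I\<close> pos cop]) auto
    then have "\<psi> h = \<one>\<^bsub>G \<times>\<times> ?Z\<^esub>"
      using h(2) unfolding \<pi>_def by (metis one_DirProd prod.collapse)
    also have "\<dots> = \<psi> \<one>\<^bsub>H\<^esub>"
      using hom H G by (intro hom_one[symmetric] DirProd_group) auto
    finally show ?thesis
      using inj h(1) H by (simp add: inj_on_eq_iff group.is_monoid monoid.one_closed)
  qed
  obtain U :: "_ \<Rightarrow> 'h \<Rightarrow> 'h" and J where U: "linear_isometric_action G U" and mix: "mixing G U"
    and J: "linear_isometry J" "\<And>v. J (J v) = - v" "\<And>g v. g \<in> carrier G \<Longrightarrow> U g (J v) = J (U g v)"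
    using complex_regular_representation[OF G B e] by blast
  note twisted = U J H \<pi> \<omega>_mult \<omega>_norm
  let ?\<rho> = "twisted_representation U J \<pi> \<omega>"
  have act: "linear_isometric_action H ?\<rho>"
    by (rule linear_isometric_action_twisted[OF twisted])
  moreover have "properly_discontinuous_action H
      (stiefel_topology :: ((real, 'p) vec \<Rightarrow>\<^sub>L 'h) topology) stiefel_diffeos (induced_stiefel_action ?\<rho>)"
  proof (rule mixing_properly_discontinuous_stiefel[OF act])
    show "mixing H ?\<rho>"
      by (rule mixing_twisted[OF twisted mix fib])
    show "?\<rho> h v \<noteq> v" if "h \<in> carrier H" "h \<noteq> \<one>\<^bsub>H\<^esub>" "v \<noteq> 0" for h v
      by (rule twisted_free[OF twisted mix fib tf faithful that])
  qed
  ultimately show ?thesis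
    by (intro exI conjI)
qed

text \<open>The translations themselves act as required, since every nontrivial element has infinite
  order.\<close>

lemma torsion_free_properly_discontinuous_grassmann_action:
  fixes B :: "'h::{real_inner, complete_space} set"
  assumes G: "group G" and tf: "torsion_free G"
    and B: "hilbert_basis B" and e: "bij_betw e (carrier G \<times> (UNIV :: bool set)) B"
  shows "\<exists>\<phi>. properly_discontinuous_action G
      (grassmann_topology :: ((real, 'p::finite) vec \<Rightarrow>\<^sub>L 'h) set topology) grassmann_diffeos \<phi>"
proof -
  obtain U :: "_ \<Rightarrow> 'h \<Rightarrow> 'h" where U: "linear_isometric_action G U" "mixing G U"
    by (rule complex_regular_representation[OF G B e], rule that)
  show ?thesis
    by (rule exI, rule mixing_properly_discontinuous_grassmann[OF U])
      (use tf in \<open>auto simp: torsion_free_def\<close>)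
qed

theorem theorem1p1:
  fixes G :: "'g monoid" and H :: "'a monoid"
    and k :: nat and q \<alpha> :: "nat \<Rightarrow> nat"
    and B :: "'h::{real_inner, complete_space} set"
  assumes "group G" and "torsion_free G"
    and "\<And>i. i \<in> {1..k} \<Longrightarrow> prime (q i)"
    and "\<And>i. i \<in> {1..k} \<Longrightarrow> \<alpha> i \<ge> 1"
    and "group H"
    and "H \<cong> G \<times>\<times> product_group {1..k} (\<lambda>i. integer_mod_group (q i ^ \<alpha> i))"
    and "infinite_dimensional TYPE('h)"
    and "hilbert_basis B" and "B \<approx> carrier G"
  shows "((\<exists>\<rho> :: 'a \<Rightarrow> 'h \<Rightarrow> 'h. linear_isometric_action H \<rho> \<and>
            properly_discontinuous_action H
              (stiefel_topology :: ((real, 'p::finite) vec \<Rightarrow>\<^sub>L 'h) topology)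
              stiefel_diffeos (induced_stiefel_action \<rho>))
          \<longleftrightarrow> (\<forall>i\<in>{1..k}. \<forall>j\<in>{1..k}. i \<noteq> j \<longrightarrow> q i \<noteq> q j)) \<and>
         (\<exists>\<phi>. properly_discontinuous_action G
            (grassmann_topology :: ((real, 'p) vec \<Rightarrow>\<^sub>L 'h) set topology)
            grassmann_diffeos \<phi>)"
proof -
  \<comment> \<open>This is where infinite dimension meets the cardinality hypothesis: doubling the
    infinite index set \<open>G\<close> keeps its cardinality, so \<open>B\<close> can be labelled
    by two copies of \<open>G\<close>.\<close>
  have "infinite (carrier G)"
    using infinite_hilbert_basis[OF assms(7,8)] eqpoll_finite_iff[OF assms(9)] by simp
  then have "carrier G \<times> (UNIV :: bool set) \<approx> B"
    using infinite_times_bool_eqpoll assms(9) eqpoll_sym eqpoll_trans by blast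
  then obtain e where e: "bij_betw e (carrier G \<times> (UNIV :: bool set)) B"
    unfolding eqpoll_def by blast
  show ?thesis
  proof (intro conjI iffI ballI impI)
    fix i j
    assume "\<exists>\<rho> :: 'a \<Rightarrow> 'h \<Rightarrow> 'h. linear_isometric_action H \<rho> \<and>
            properly_discontinuous_action H
              (stiefel_topology :: ((real, 'p::finite) vec \<Rightarrow>\<^sub>L 'h) topology)
              stiefel_diffeos (induced_stiefel_action \<rho>)"
      and ij: "i \<in> {1..k}" "j \<in> {1..k}" "i \<noteq> j"
    then obtain \<rho> :: "'a \<Rightarrow> 'h \<Rightarrow> 'h" where \<rho>: "linear_isometric_action H \<rho>"
      "properly_discontinuous_action H
              (stiefel_topology :: ((real, 'p::finite) vec \<Rightarrow>\<^sub>L 'h) topology)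
              stiefel_diffeos (induced_stiefel_action \<rho>)"
      by (elim exE conjE)
    show "q i \<noteq> q j"
      using noncyclic_product_no_properly_discontinuous_stiefel_action[OF assms(7) \<rho>(1) assms(1,6) ij
          _ assms(3)[OF ij(1)] assms(4)[OF ij(1)] assms(4)[OF ij(2)]] \<rho>(2)
      by metis
  next
    assume "\<forall>i\<in>{1..k}. \<forall>j\<in>{1..k}. i \<noteq> j \<longrightarrow> q i \<noteq> q j"
    then show "\<exists>\<rho> :: 'a \<Rightarrow> 'h \<Rightarrow> 'h. linear_isometric_action H \<rho> \<and>
            properly_discontinuous_action H
              (stiefel_topology :: ((real, 'p::finite) vec \<Rightarrow>\<^sub>L 'h) topology)
              stiefel_diffeos (induced_stiefel_action \<rho>)"
      by (intro cyclic_product_properly_discontinuous_stiefel_action[OF assms(1,2,5) finite_atLeastAtMost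
            assms(3) _ assms(6,8) e]) auto
  next
    show "\<exists>\<phi>. properly_discontinuous_action G
            (grassmann_topology :: ((real, 'p) vec \<Rightarrow>\<^sub>L 'h) set topology)
            grassmann_diffeos \<phi>"
      by (rule torsion_free_properly_discontinuous_grassmann_action[OF assms(1,2,8) e])
  qed
qed

end
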